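(* Suppose that $\hat{\Sigma}_x[i,j]\neq 0$ for all $i,j\in\{0,\ldots,L-1\}$. Then the estimator $\widetilde{C}_x$ computed from $N$ i.i.d. observations $y_1,\ldots,y_N$ (as described in the context) satisfies $$\min_{\varphi_1,\ldots,\varphi_{L-1}\in[0,2\pi)}\left\Vert\widetilde{C}_x-\hat{\Sigma}_x\odot\operatorname{Circulant}\left\{[1,e^{\imath\varphi_1},\ldots,e^{\imath\varphi_{L-1}}]\right\}\right\Vert_F\longrightarrow 0$$ almost surely as $N\to\infty$.
   Context: All indices are in $\{0,\ldots,L-1\}$ and are taken modulo $L$. $\overline{(\cdot)}$ is complex conjugation, $(\cdot)^*$ is conjugate transpose, $\odot$ is the entrywise product, $\|\cdot\|_F$ is the Frobenius norm, and $\operatorname{Circulant}\{z\}[k_1,k_2]=z[\operatorname{mod}(k_2-k_1,L)]$ for $z\in\mathbb{C}^L$. $G\succeq 0$ means $G$ is Hermitian positive semidefinite. Model (complex-valued). $y=R_s\{x\}+\eta\in\mathbb{C}^L$ with $x=\sum_{i=1}^r a_iv_i$, where $v_1,\ldots,v_r\in\mathbb{C}^L$ are orthonormal, $a_1,\ldots,a_r$ are independent with $a_i\sim\mathbb{C}\mathcal{N}(0,\lambda_i)$, $\lambda_i>0$ (circularly-symmetric complex normal), $\eta\sim\mathbb{C}\mathcal{N}(0,\sigma^2I_L)$ with known variance $\sigma^2\ge0$, $R_s\{x\}[\ell]=x[\ell-s]$ is the cyclic shift, and $s$ is a random element of $\mathbb{Z}_L$ with arbitrary distribution; $\{a_i\}$,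 $s$, $\eta$ are mutually independent. $y_1,\ldots,y_N$ are i.i.d. copies of $y$. $F[\ell,k]=\frac{1}{\sqrt L}e^{-\imath2\pi k\ell/L}$ is the unitary DFT matrix, $\hat{y}_i=Fy_i$, and $\hat{\Sigma}_x=\mathbb{E}[\hat{x}\hat{x}^*]$ with $\hat{x}=Fx$. Estimator $\widetilde{C}_x$. Let $\widetilde{P}_y[k_1]=\frac1N\sum_{i=1}^N|\hat{y}_i[k_1]|^2$ and $\widetilde{T}_y[k_1,k_2,k_3]=\frac1N\sum_{i=1}^N\hat{y}_i[k_1]\overline{\hat{y}_i[k_2]}\hat{y}_i[k_3]\overline{\hat{y}_i[k_1-k_2+k_3]}$. Let $\{\widetilde{G}_m\}_{m=1}^{L-1}$ be a minimizer, over $L\times L$ complex matrices $\{G'_m\}_{m=1}^{L-1}$, of $$\sum_{k_1,k_2,m=0}^{L-1}\left|\widetilde{T}_y[k_1,k_1+m,k_2+m]-G'_{k_2-k_1}[k_1,k_1+m]-G'_m[k_1,k_2]\right|^2$$ subject to $G'_m\succeq0$ for $m=1,\ldots,L-1$ and $G'_0=\widetilde{P}_y\widetilde{P}_y^T$. For $m=1,\ldots,L-1$ let $\widetilde{\mu}_1^{(m)}$ be the largest eigenvalue of $\widetilde{G}_m$, $\widetilde{u}_1^{(m)}$ a corresponding unit-norm eigenvector, and $\widetilde{d}_m=\sqrt{\widetilde{\mu}_1^{(m)}}\,\widetilde{u}_1^{(m)}$. Finally, $\widetilde{C}_x[k_1,k_2]=\widetilde{d}_m[k_1]$ if $\operatorname{mod}(k_2-k_1,L)=m\in\{1,\ldots,L-1\}$,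 and $\widetilde{C}_x[k_1,k_1]=\widetilde{P}_y[k_1]-\sigma^2$. *)

theory Defs
  imports "HOL-Probability.Probability" "Berlekamp_Zassenhaus.Finite_Field"
begin

text \<open>
  The index group of integers modulo \<open>L\<close> is the type \<open>'n mod_ring\<close> with \<open>L = CARD('n)\<close>, an
  arbitrary positive integer. Its \<open>+\<close> and \<open>-\<close> are taken modulo \<open>L\<close>, and \<^const>\<open>to_int_mod_ring\<close>
  yields the representative in \<open>{0..<L}\<close>. Vectors are \<open>complex ^ 'n mod_ring\<close>; \<open>A $ i $ j\<close> is the
  entry in row \<open>i\<close> and column \<open>j\<close>.
\<close>

section \<open>Vectors and matrices\<close>

definition cinner :: "complex ^ 'k::finite \<Rightarrow> complex ^ 'k \<Rightarrow> complex" where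
  "cinner u v = (\<Sum>k\<in>UNIV. cnj (u $ k) * v $ k)"

definition conj_transpose :: "complex ^ 'k ^ 'm \<Rightarrow> complex ^ 'm ^ 'k" where
  "conj_transpose A = (\<chi> i j. cnj (A $ j $ i))"

text \<open>For Hermitian \<open>A\<close> the quadratic form is real-valued, so \<^const>\<open>Re\<close> loses nothing.\<close>

definition psd :: "complex ^ 'k ^ 'k::finite \<Rightarrow> bool" where
  "psd A \<longleftrightarrow> conj_transpose A = A \<and> (\<forall>u. 0 \<le> Re (cinner u (A *v u)))"

definition mat_eigenvalue :: "complex ^ 'k ^ 'k::finite \<Rightarrow> complex \<Rightarrow> bool" where
  "mat_eigenvalue A z \<longleftrightarrow> (\<exists>u. u \<noteq> 0 \<and> A *v u = z *s u)"

text \<open>Used for Hermitian matrices only, all of whose eigenvalues are real.\<close>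

definition largest_eigenvalue :: "complex ^ 'k ^ 'k::finite \<Rightarrow> real \<Rightarrow> bool" where
  "largest_eigenvalue A mu \<longleftrightarrow>
     mat_eigenvalue A (of_real mu) \<and> (\<forall>nu::real. mat_eigenvalue A (of_real nu) \<longrightarrow> nu \<le> mu)"

definition hadamard :: "complex ^ 'k ^ 'm \<Rightarrow> complex ^ 'k ^ 'm \<Rightarrow> complex ^ 'k ^ 'm" where
  "hadamard A B = (\<chi> i j. A $ i $ j * B $ i $ j)"

definition circulant :: "complex ^ 'n::finite mod_ring \<Rightarrow> complex ^ 'n mod_ring ^ 'n mod_ring" where
  "circulant z = (\<chi> k1 k2. z $ (k2 - k1))"

definition cyclic_shift ::
    "'n::finite mod_ring \<Rightarrow> complex ^ 'n mod_ring \<Rightarrow> complex ^ 'n mod_ring" where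
  "cyclic_shift s x = (\<chi> l. x $ (l - s))"

definition dft_matrix :: "complex ^ 'n::finite mod_ring ^ 'n mod_ring" where
  "dft_matrix = (\<chi> l k. of_real (1 / sqrt (real CARD('n))) *
     exp (- \<i> * of_real (2 * pi * real_of_int (to_int_mod_ring k) * real_of_int (to_int_mod_ring l)
                         / real CARD('n))))"

definition dft :: "complex ^ 'n::finite mod_ring \<Rightarrow> complex ^ 'n mod_ring" where
  "dft x = dft_matrix *v x"

text \<open>The library norm on matrices is the Frobenius norm.\<close>

lemma norm_matrix_eq_Frobenius:
  fixes A :: "complex ^ 'k::finite ^ 'm::finite"
  shows "norm A = sqrt (\<Sum>i\<in>UNIV. \<Sum>j\<in>UNIV. (cmod (A $ i $ j))\<^sup>2)"
  by (simp add: norm_vec_def L2_set_def sum_nonneg)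

section \<open>Complex normal distributions\<close>

text \<open>
  The circularly-symmetric complex normal distribution of variance \<open>v\<close>: real and imaginary parts
  are independent and normal with mean \<open>0\<close> and variance \<open>v / 2\<close>. For \<open>v = 0\<close> it is the point mass
  at \<open>0\<close>.
\<close>

definition complex_normal :: "real \<Rightarrow> complex measure" where
  "complex_normal v =
     (if v = 0 then return borel 0
      else distr (density lborel (\<lambda>x. ennreal (normal_density 0 (sqrt (v / 2)) x)) \<Otimes>\<^sub>M
                  density lborel (\<lambda>x. ennreal (normal_density 0 (sqrt (v / 2)) x)))
                 borel (\<lambda>(x, y). Complex x y))"

text \<open>
  With covariance matrix \<open>v\<close> times the identity: the entries are independent complex normal
  variables of variance \<open>v\<close>.
\<close>

definition complex_normal_vec :: "real \<Rightarrow> (complex ^ 'k::finite) measure" where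
  "complex_normal_vec v =
     distr (PiM (UNIV :: 'k set) (\<lambda>_. complex_normal v)) borel (\<lambda>z. \<chi> k. z k)"

section \<open>The observation model\<close>

definition signal ::
    "nat \<Rightarrow> (nat \<Rightarrow> complex ^ 'k) \<Rightarrow> (nat \<Rightarrow> 'p \<Rightarrow> complex) \<Rightarrow> 'p \<Rightarrow> complex ^ 'k" where
  "signal r v a \<omega> = (\<Sum>i=1..r. a i \<omega> *s v i)"

definition observation ::
    "('p \<Rightarrow> complex ^ 'n::finite mod_ring) \<Rightarrow> ('p \<Rightarrow> 'n mod_ring) \<Rightarrow>
     ('p \<Rightarrow> complex ^ 'n mod_ring) \<Rightarrow> 'p \<Rightarrow> complex ^ 'n mod_ring" where
  "observation x s eta \<omega> = cyclic_shift (s \<omega>) (x \<omega>) + eta \<omega>"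

text \<open>
  Mutual independence of \<open>a 1, \<dots>, a r, s, eta\<close>. It is expressed as in \<open>indep_vars_def2\<close>, through
  the families of events generated by each variable, because \<open>indep_vars\<close> requires all random
  variables to have the same type of values.
\<close>

datatype source = Coefficient nat | Shift | Noise

definition source_events ::
    "'p measure \<Rightarrow> (nat \<Rightarrow> 'p \<Rightarrow> complex) \<Rightarrow> ('p \<Rightarrow> 'n::finite mod_ring) \<Rightarrow>
     ('p \<Rightarrow> complex ^ 'n mod_ring) \<Rightarrow> source \<Rightarrow> 'p set set" where
  "source_events P a s eta j =
     (case j of
        Coefficient i \<Rightarrow> {a i -` A \<inter> space P |A. A \<in> sets borel}
      | Shift \<Rightarrow> {s -` A \<inter> space P |A. A \<in> sets (count_space UNIV)}
      | Noise \<Rightarrow> {eta -` A \<inter> space P |A. A \<in> sets borel})"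

definition indep_sources ::
    "'p measure \<Rightarrow> nat \<Rightarrow> (nat \<Rightarrow> 'p \<Rightarrow> complex) \<Rightarrow> ('p \<Rightarrow> 'n::finite mod_ring) \<Rightarrow>
     ('p \<Rightarrow> complex ^ 'n mod_ring) \<Rightarrow> bool" where
  "indep_sources P r a s eta \<longleftrightarrow>
     prob_space.indep_sets P (source_events P a s eta) (Coefficient ` {1..r} \<union> {Shift, Noise})"

definition fourier_covariance ::
    "'p measure \<Rightarrow> ('p \<Rightarrow> complex ^ 'n::finite mod_ring) \<Rightarrow> complex ^ 'n mod_ring ^ 'n mod_ring" where
  "fourier_covariance P x = (\<chi> i j. \<integral>\<omega>. dft (x \<omega>) $ i * cnj (dft (x \<omega>) $ j) \<partial>P)"

section \<open>The estimator\<close>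

definition power_spectrum_est ::
    "nat \<Rightarrow> (nat \<Rightarrow> complex ^ 'n::finite mod_ring) \<Rightarrow> real ^ 'n mod_ring" where
  "power_spectrum_est N y = (\<chi> k. 1 / real N * (\<Sum>i=1..N. (cmod (dft (y i) $ k))\<^sup>2))"

definition trispectrum_est ::
    "nat \<Rightarrow> (nat \<Rightarrow> complex ^ 'n::finite mod_ring) \<Rightarrow>
     'n mod_ring \<Rightarrow> 'n mod_ring \<Rightarrow> 'n mod_ring \<Rightarrow> complex" where
  "trispectrum_est N y k1 k2 k3 =
     1 / of_nat N * (\<Sum>i=1..N. dft (y i) $ k1 * cnj (dft (y i) $ k2) *
                                dft (y i) $ k3 * cnj (dft (y i) $ (k1 - k2 + k3)))"

definition ls_objective ::
    "('n::finite mod_ring \<Rightarrow> 'n mod_ring \<Rightarrow> 'n mod_ring \<Rightarrow> complex) \<Rightarrow>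
     ('n mod_ring \<Rightarrow> complex ^ 'n mod_ring ^ 'n mod_ring) \<Rightarrow> real" where
  "ls_objective T G =
     (\<Sum>k1\<in>UNIV. \<Sum>k2\<in>UNIV. \<Sum>m\<in>UNIV.
        (cmod (T k1 (k1 + m) (k2 + m) - G (k2 - k1) $ k1 $ (k1 + m) - G m $ k1 $ k2))\<^sup>2)"

definition ls_feasible ::
    "real ^ 'n::finite mod_ring \<Rightarrow>
     ('n mod_ring \<Rightarrow> complex ^ 'n mod_ring ^ 'n mod_ring) \<Rightarrow> bool" where
  "ls_feasible p G \<longleftrightarrow>
     (\<forall>m. m \<noteq> 0 \<longrightarrow> psd (G m)) \<and> G 0 = (\<chi> i j. of_real (p $ i * p $ j))"

definition ls_minimizer ::
    "real ^ 'n::finite mod_ring \<Rightarrow>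
     ('n mod_ring \<Rightarrow> 'n mod_ring \<Rightarrow> 'n mod_ring \<Rightarrow> complex) \<Rightarrow>
     ('n mod_ring \<Rightarrow> complex ^ 'n mod_ring ^ 'n mod_ring) \<Rightarrow> bool" where
  "ls_minimizer p T G \<longleftrightarrow>
     ls_feasible p G \<and> (\<forall>G'. ls_feasible p G' \<longrightarrow> ls_objective T G \<le> ls_objective T G')"

text \<open>
  The minimizer and the unit eigenvectors need not be unique, so the estimator is a relation: \<open>C\<close> is
  an output of the procedure on \<open>y 1, \<dots>, y N\<close> for some admissible choice of them.
\<close>

definition covariance_estimate ::
    "real \<Rightarrow> nat \<Rightarrow> (nat \<Rightarrow> complex ^ 'n::finite mod_ring) \<Rightarrow>
     complex ^ 'n mod_ring ^ 'n mod_ring \<Rightarrow> bool" where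
  "covariance_estimate sigma2 N y C \<longleftrightarrow>
     (\<exists>G mu u.
        ls_minimizer (power_spectrum_est N y) (trispectrum_est N y) G \<and>
        (\<forall>m. m \<noteq> 0 \<longrightarrow>
           largest_eigenvalue (G m) (mu m) \<and> G m *v u m = of_real (mu m) *s u m \<and> norm (u m) = 1) \<and>
        C = (\<chi> k1 k2.
               if k2 - k1 = 0 then of_real (power_spectrum_est N y $ k1 - sigma2)
               else (of_real (sqrt (mu (k2 - k1))) *s u (k2 - k1)) $ k1))"

section \<open>The error up to circulant phases\<close>

text \<open>Only the values of \<open>\<phi>\<close> at nonzero indices matter.\<close>

definition phase_vector :: "('n::finite mod_ring \<Rightarrow> real) \<Rightarrow> complex ^ 'n mod_ring" where
  "phase_vector \<phi> = (\<chi> m. if m = 0 then 1 else exp (\<i> * of_real (\<phi> m)))"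

definition phase_error ::
    "complex ^ 'n::finite mod_ring ^ 'n mod_ring \<Rightarrow> complex ^ 'n mod_ring ^ 'n mod_ring \<Rightarrow> real" where
  "phase_error C S =
     Inf ((\<lambda>\<phi>. norm (C - hadamard S (circulant (phase_vector \<phi>)))) `
          {\<phi>. \<forall>m. m \<noteq> 0 \<longrightarrow> \<phi> m \<in> {0..<2 * pi}})"

text \<open>The infimum is attained, so it is a minimum.\<close>

lemma phase_error_attained:
  fixes C S :: "complex ^ 'n::finite mod_ring ^ 'n mod_ring"
  shows "\<exists>\<phi>. (\<forall>m. m \<noteq> 0 \<longrightarrow> \<phi> m \<in> {0..<2 * pi}) \<and>
             phase_error C S = norm (C - hadamard S (circulant (phase_vector \<phi>))) \<and>
             (\<forall>\<psi>. (\<forall>m. m \<noteq> 0 \<longrightarrow> \<psi> m \<in> {0..<2 * pi}) \<longrightarrow>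
                   phase_error C S \<le> norm (C - hadamard S (circulant (phase_vector \<psi>))))"
proof -
  define Z where "Z = {z :: complex ^ 'n mod_ring. z $ 0 = 1 \<and> (\<forall>m. cmod (z $ m) = 1)}"
  define f where "f z = norm (C - hadamard S (circulant z))" for z
  have "closed Z"
    unfolding Z_def
    by (intro closed_Collect_conj closed_Collect_all closed_Collect_eq continuous_intros)
  moreover have "bounded Z"
  proof -
    have "norm z \<le> (\<Sum>m\<in>(UNIV :: 'n mod_ring set). 1)" if "z \<in> Z" for z
      using that L2_set_le_sum[of UNIV "\<lambda>m. cmod (z $ m)"] unfolding Z_def norm_vec_def by simp
    then show ?thesis by (meson boundedI)
  qed
  ultimately have "compact Z" by (simp add: compact_eq_bounded_closed)
  moreover have "(\<chi> m. 1) \<in> Z" by (simp add: Z_def)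
  then have "Z \<noteq> {}" by blast
  moreover have "continuous_on Z f"
    unfolding f_def hadamard_def circulant_def by (intro continuous_intros)
  ultimately obtain z where z: "z \<in> Z" "\<And>w. w \<in> Z \<Longrightarrow> f z \<le> f w"
    using continuous_attains_inf[of Z f] by blast
  define \<phi> where "\<phi> m = Arg2pi (z $ m)" for m
  have \<phi>: "\<phi> m \<in> {0..<2 * pi}" for m
    unfolding \<phi>_def using Arg2pi_ge_0 Arg2pi_lt_2pi by auto
  have "exp (\<i> * of_real (\<phi> m)) = z $ m" for m
    using z(1) Arg2pi_eq[of "z $ m"] unfolding \<phi>_def Z_def by simp
  then have "phase_vector \<phi> = z"
    using z(1) unfolding phase_vector_def Z_def by (simp add: vec_eq_iff)
  moreover have "phase_vector \<psi> \<in> Z" for \<psi> :: "'n mod_ring \<Rightarrow> real"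
    by (simp add: Z_def phase_vector_def)
  ultimately have min: "norm (C - hadamard S (circulant (phase_vector \<phi>)))
      \<le> norm (C - hadamard S (circulant (phase_vector \<psi>)))" for \<psi>
    using z(2) unfolding f_def by simp
  have "phase_error C S = norm (C - hadamard S (circulant (phase_vector \<phi>)))"
    unfolding phase_error_def using \<phi> min by (intro cInf_eq_minimum) auto
  then show ?thesis using \<phi> min by (intro exI[of _ \<phi>]) auto
qed

end

theory Submission
  imports Defs "HOL-Library.Discrete_Functions"
begin

text \<open>
  Let \<open>\<Sigma>\<close> be the Fourier covariance of the signal and \<open>S = \<Sigma> + \<sigma>\<^sup>2 I\<close>. Conditionally on the shift \<open>t\<close>, the
  Fourier transform of an observation is a circular complex Gaussian vector with covariance
  \<open>S k l\<close> times a phase that depends on \<open>t * (k - l)\<close> only, so Isserlis' formula gives the limits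
  \<open>S k k\<close> and \<open>S k1 (k1 + m) * cnj (S k2 (k2 + m)) + S k1 k2 * cnj (S (k1 + m) (k2 + m))\<close> of the
  empirical spectra. The matrices \<open>D m = d m (d m)\<^sup>*\<close> with \<open>d m k = S k (k + m)\<close> fit these limits exactly,
  hence the residuals of the minimizers \<open>G m\<close> tend to \<open>0\<close>.

  The resulting equations for the limits do determine them: \<open>k2 = k1\<close> yields the diagonal of \<open>G m\<close>, and
  \<open>k2 = k1 + m\<close> its entries \<open>(k, k + m)\<close>. A positive semidefinite matrix that agrees with the
  rank-one matrix \<open>D m\<close>, all of whose entries are nonzero, on the diagonal and at the entries \<open>(k, k + 1)\<close>
  is equal to it. This settles \<open>m = 1\<close>; then \<open>k2 = k1 + 1\<close> yields the entries \<open>(k, k + 1)\<close> of every \<open>G m\<close>.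
  Finally, the leading eigenvector of a matrix near \<open>d d\<^sup>*\<close>, scaled by the square root of its
  eigenvalue, is near \<open>d\<close> up to a phase.
\<close>

section \<open>Positive semidefinite matrices\<close>

text \<open>The minimizer need not be unique, is chosen arbitrarily for every \<open>N\<close> and
  every sample, and is not known in advance to converge. The argument therefore uses neither
  compactness nor measurability of the choice: probability enters only through the limits of
  finitely many empirical averages, and everything after that is deterministic for a fixed sample.
  Each residual involves two unknown entries. Residual limits are combined so that only one entry is
  left, whose partner is fixed by the constraint on \<open>G 0\<close>, or equal to it, or already
  determined; this dictates the order diagonal, \<open>m = 1\<close>, general \<open>m\<close>. In
  each matrix the linear equations are used only for the diagonal and for one line of off-diagonal
  entries. Positive semidefiniteness supplies the rest, and nonzero entries are what allows it to
  pass from one column to the next. Gaussian variables have moments of every order, so a strong law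
  based on second moments suffices.\<close>

lemma cinner_add_right: "cinner u (v + w) = cinner u v + cinner u w"
  by (simp add: cinner_def distrib_left sum.distrib)

lemma cinner_add_left: "cinner (u + v) w = cinner u w + cinner v w"
  by (simp add: cinner_def distrib_right sum.distrib)

lemma cinner_diff_right: "cinner u (v - w) = cinner u v - cinner u w"
  by (simp add: cinner_def right_diff_distrib sum_subtractf)

lemma cinner_diff_left: "cinner (u - v) w = cinner u w - cinner v w"
  by (simp add: cinner_def left_diff_distrib sum_subtractf)

lemma cinner_scale_right: "cinner u (c *s v) = c * cinner u v"
  by (simp add: cinner_def sum_distrib_left mult_ac)

lemma cinner_scale_left: "cinner (c *s u) v = cnj c * cinner u v"
  by (simp add: cinner_def sum_distrib_left mult_ac)

lemma cnj_cinner: "cnj (cinner u v) = cinner v u"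
  by (simp add: cinner_def mult_ac)

lemma cinner_self: "cinner u u = of_real ((norm u)\<^sup>2)"
  by (simp add: cinner_def norm_vec_def L2_set_def sum_nonneg mult.commute flip: complex_norm_square)

lemma hermitian_entry:
  assumes "conj_transpose A = A"
  shows "A $ j $ i = cnj (A $ i $ j)"
  by (subst assms[symmetric]) (simp add: conj_transpose_def)

lemma cinner_hermitian:
  assumes "conj_transpose A = A"
  shows "cinner (A *v u) w = cinner u (A *v w)"
proof -
  have "cinner (A *v u) w = (\<Sum>i\<in>UNIV. \<Sum>j\<in>UNIV. cnj (A $ i $ j) * cnj (u $ j) * w $ i)"
    by (simp add: cinner_def matrix_vector_mult_def sum_distrib_right)
  also have "\<dots> = (\<Sum>j\<in>UNIV. \<Sum>i\<in>UNIV. A $ j $ i * cnj (u $ j) * w $ i)"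
    by (subst sum.swap) (simp flip: hermitian_entry[OF assms])
  also have "\<dots> = cinner u (A *v w)"
    by (simp add: cinner_def matrix_vector_mult_def sum_distrib_left mult_ac)
  finally show ?thesis .
qed

lemma quadratic_nonneg_discriminant:
  fixes a b c :: real
  assumes q: "\<And>t. 0 \<le> a + 2 * b * t + c * t\<^sup>2"
  shows "b\<^sup>2 \<le> a * c"
proof (cases "c = 0")
  case True
  have "b = 0"
  proof (rule ccontr)
    assume "b \<noteq> 0"
    then show False using q[of "- (a + 1) / (2 * b)"] True by simp
  qed
  then show ?thesis using True by simp
next
  case False
  have "c \<ge> 0"
  proof (rule ccontr)
    assume "\<not> c \<ge> 0"
    then have c: "c < 0" by simp
    have a: "a \<ge> 0" using q[of 0] by simp
    \<comment> \<open>Chosen so that \<open>c * t = c - a - 2 * \<bar>b\<bar>\<close> with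
      \<open>t \<ge> 1\<close>. The polynomial is then at most
      \<open>(a + 2 * \<bar>b\<bar> + c * t) * t = c * t < 0\<close>.\<close>
    define t where "t = 1 + (a + 2 * \<bar>b\<bar>) / (- c)"
    have t1: "t \<ge> 1" using a c by (simp add: t_def divide_nonneg_nonpos)
    have ct: "c * t = c - a - 2 * \<bar>b\<bar>" using c by (simp add: t_def right_diff_distrib)
    have "2 * b * t \<le> 2 * \<bar>b\<bar> * t" using t1 by (intro mult_right_mono) auto
    moreover have "a \<le> a * t" using a t1 by (simp add: mult_le_cancel_left1)
    ultimately have "a + 2 * b * t + c * t\<^sup>2 \<le> a * t + 2 * \<bar>b\<bar> * t + (c * t) * t"
      by (simp add: power2_eq_square)
    also have "\<dots> = (a + 2 * \<bar>b\<bar> + c * t) * t" by (simp add: algebra_simps)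
    also have "\<dots> = c * t" by (simp add: ct)
    also have "\<dots> < 0" using c t1 by (simp add: mult_neg_pos)
    finally show False using q[of t] by linarith
  qed
  then have c: "c > 0" using False by simp
  \<comment> \<open>The value at the vertex \<open>- b / c\<close>, multiplied by
    \<open>c\<close>.\<close>
  have "0 \<le> c * (a + 2 * b * (- b / c) + c * (- b / c)\<^sup>2)"
    by (intro mult_nonneg_nonneg q) (use c in simp)
  also have "\<dots> = a * c - b\<^sup>2" using False by (simp add: field_simps power2_eq_square)
  finally show ?thesis by simp
qed

text \<open>The form may be degenerate, so the bound comes from a discriminant. Along
  \<open>u + t * c * w\<close> with real \<open>t\<close> the form is a real quadratic polynomial
  that is never negative; the unimodular \<open>c\<close> undoes the phase of \<open>z\<close>, so
  that the cross term is the full modulus.\<close>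

lemma psd_Cauchy_Schwarz:
  assumes "psd A"
  shows "(cmod (cinner u (A *v w)))\<^sup>2 \<le> Re (cinner u (A *v u)) * Re (cinner w (A *v w))"
proof -
  define z where "z = cinner u (A *v w)"
  define c where "c = exp (- \<i> * of_real (Arg z))"
  have herm: "conj_transpose A = A" and pos: "\<And>u. 0 \<le> Re (cinner u (A *v u))"
    using assms by (auto simp: psd_def)
  have c1: "cnj c * c = 1"
    by (simp add: c_def exp_cnj flip: exp_add)
  have "z = of_real (cmod z) * exp (\<i> * of_real (Arg z))"
    by (cases "z = 0") (use Arg_eq in auto)
  then have cz: "c * z = of_real (cmod z)"
    by (metis (no_types, lifting) c_def exp_minus_inverse mult.left_commute mult.right_neutral
        mult_minus_left mult.commute)
  have wu: "cinner w (A *v u) = cnj z"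
    by (metis cinner_hermitian cnj_cinner herm z_def)
  have "0 \<le> Re (cinner u (A *v u)) + 2 * cmod z * t + Re (cinner w (A *v w)) * t\<^sup>2" for t
  proof -
    define x where "x = (of_real t * c) *s w"
    have "cinner (u + x) (A *v (u + x)) = cinner u (A *v u) + of_real t * (c * z)
        + of_real t * cnj (c * z) + (cnj c * c) * (of_real (t\<^sup>2) * cinner w (A *v w))"
      by (simp add: x_def cinner_add_left cinner_add_right matrix_vector_right_distrib
          vector_scalar_commute cinner_scale_left cinner_scale_right wu power2_eq_square
          algebra_simps flip: z_def)
    then show ?thesis
      using pos[of "u + x"] unfolding cz c1 by (simp add: mult_ac)
  qed
  from quadratic_nonneg_discriminant[OF this] show ?thesis by (simp add: z_def)
qed

lemma cinner_mult_axis: "cinner (axis i 1) w = w $ i"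
proof -
  have "cinner (axis i 1) w = (\<Sum>k\<in>UNIV. if k = i then w $ k else 0)"
    unfolding cinner_def axis_def by (intro sum.cong) auto
  then show ?thesis by simp
qed

lemma matrix_vector_mult_axis: "(A *v axis j (1::complex)) $ i = A $ i $ j"
proof -
  have "(A *v axis j (1::complex)) $ i = (\<Sum>k\<in>UNIV. if k = j then A $ i $ k else 0)"
    by (simp add: matrix_vector_mult_def axis_def if_distrib[of "\<lambda>x. _ * x"] cong: if_cong)
  then show ?thesis by simp
qed

lemma cmod_cinner_le: "cmod (cinner u v) \<le> norm u * norm v"
proof -
  have "psd (mat 1 :: complex ^ 'a ^ 'a)"
    by (auto simp: psd_def cinner_self) (simp add: conj_transpose_def mat_def vec_eq_iff)
  from psd_Cauchy_Schwarz[OF this, of u v] show ?thesis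
    by (metis (no_types, lifting) Re_complex_of_real cinner_self matrix_vector_mul_lid
        mult_nonneg_nonneg norm_ge_zero power2_le_imp_le power_mult_distrib)
qed

lemma hermitian_max_eigenvalue:
  fixes A :: "complex ^ 'k::finite ^ 'k"
  assumes herm: "conj_transpose A = A"
  shows "\<exists>\<rho>::real. mat_eigenvalue A (of_real \<rho>) \<and>
           (\<forall>u. Re (cinner u (A *v u)) \<le> \<rho> * (norm u)\<^sup>2)"
proof -
  let ?q = "\<lambda>u. Re (cinner u (A *v u))"
  have "axis undefined 1 \<in> sphere (0 :: complex ^ 'k) 1"
    by (simp add: norm_axis_1)
  then have ne: "sphere (0 :: complex ^ 'k) 1 \<noteq> {}" by blast
  have "continuous_on (sphere 0 1) ?q"
    unfolding cinner_def matrix_vector_mult_def by (intro continuous_intros)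
  from continuous_attains_sup[OF compact_sphere ne this]
  obtain w where w: "norm w = 1" and max: "\<And>u. norm u = 1 \<Longrightarrow> ?q u \<le> ?q w"
    by auto
  define \<rho> where "\<rho> = ?q w"
  have le: "?q u \<le> \<rho> * (norm u)\<^sup>2" for u
  proof (cases "u = 0")
    case True
    then show ?thesis by (simp add: cinner_def)
  next
    case False
    define x where "x = of_real (1 / norm u) *s u"
    have u: "u = of_real (norm u) *s x"
      using False by (simp add: x_def vec_eq_iff)
    have "of_real ((norm x)\<^sup>2) = (1 :: complex)"
      unfolding cinner_self[symmetric] x_def cinner_scale_left cinner_scale_right
      using False by (simp add: cinner_self power2_eq_square)
    then have "(norm x)\<^sup>2 = 1" by (simp only: of_real_eq_1_iff)
    then have "norm x = 1" using norm_ge_zero[of x] by (simp only: power2_eq_1_iff) linarith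
    then have "?q x \<le> \<rho>" using max by (simp add: \<rho>_def)
    moreover have "?q u = (norm u)\<^sup>2 * ?q x"
      by (subst (1 2) u) (simp add: vector_scalar_commute cinner_scale_left cinner_scale_right
          power2_eq_square)
    ultimately show ?thesis by (simp add: mult.commute[of _ "(norm u)\<^sup>2"] mult_left_mono)
  qed
  define B where "B = (\<chi> i j. (if i = j then of_real \<rho> else 0) - A $ i $ j)"
  have B: "B *v u = of_real \<rho> *s u - A *v u" for u
  proof -
    have "(\<Sum>j\<in>UNIV. ((if i = j then of_real \<rho> else 0) - A $ i $ j) * u $ j)
        = (\<Sum>j\<in>UNIV. (if i = j then of_real \<rho> * u $ j else 0) - A $ i $ j * u $ j)" for i
      by (intro sum.cong) (auto simp: algebra_simps)
    then show ?thesis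
      by (simp add: B_def vec_eq_iff matrix_vector_mult_def sum_subtractf)
  qed
  have qB: "Re (cinner u (B *v u)) = \<rho> * (norm u)\<^sup>2 - ?q u" for u
    by (simp add: B cinner_diff_right cinner_scale_right cinner_self)
  have "conj_transpose B = B"
    by (auto simp: conj_transpose_def B_def vec_eq_iff simp flip: hermitian_entry[OF herm])
  then have "psd B"
    unfolding psd_def qB using le by simp
  from psd_Cauchy_Schwarz[OF this, of _ w]
  have "cmod (cinner u (B *v w)) = 0" for u
    by (simp add: qB w \<rho>_def)
  then have "(B *v w) $ i = 0" for i
    by (metis cinner_mult_axis norm_eq_zero)
  then have "A *v w = of_real \<rho> *s w"
    by (simp add: vec_eq_iff B)
  moreover have "w \<noteq> 0" using w by auto
  ultimately have "mat_eigenvalue A (of_real \<rho>)" unfolding mat_eigenvalue_def by (intro exI[of _ w]) simp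
  then show ?thesis using le by (intro exI[of _ \<rho>]) simp
qed

lemma largest_eigenvalue_ge_Rayleigh:
  assumes "conj_transpose A = A" "largest_eigenvalue A mu"
  shows "Re (cinner u (A *v u)) \<le> mu * (norm u)\<^sup>2"
proof -
  obtain \<rho> where "mat_eigenvalue A (of_real \<rho>)" "Re (cinner u (A *v u)) \<le> \<rho> * (norm u)\<^sup>2"
    using hermitian_max_eigenvalue[OF assms(1)] by blast
  then show ?thesis using assms(2) unfolding largest_eigenvalue_def
    by (meson mult_right_mono order_trans zero_le_power2)
qed

section \<open>Convergence of the least squares estimator\<close>

definition outer_product :: "complex ^ 'k \<Rightarrow> complex ^ 'k ^ 'k" where
  "outer_product d = (\<chi> i j. d $ i * cnj (d $ j))"

lemma outer_product_mult_vec: "outer_product d *v u = cinner d u *s d"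
  by (simp add: outer_product_def matrix_vector_mult_def cinner_def vec_eq_iff sum_distrib_left mult_ac)

lemma cinner_outer_product: "cinner u (outer_product d *v u) = of_real ((cmod (cinner d u))\<^sup>2)"
  by (simp add: outer_product_mult_vec cinner_scale_right complex_norm_square cnj_cinner del: of_real_power)

lemma psd_outer_product: "psd (outer_product d)"
  unfolding psd_def cinner_outer_product
  by (simp add: conj_transpose_def outer_product_def vec_eq_iff mult.commute)

text \<open>
  For \<open>w = e\<^sub>k / cnj d\<^sub>k - e\<^sub>l / cnj d\<^sub>l\<close> the quadratic form at \<open>w\<close> tends to \<open>1 - 1 - 1 + 1 = 0\<close>,
  and Cauchy-Schwarz for the form then forces every entry of \<open>A *v w\<close> to tend to \<open>0\<close>.
\<close>

lemma psd_tendsto_column_step: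
  fixes A :: "nat \<Rightarrow> complex ^ 'k::finite ^ 'k"
  assumes psd: "\<And>N. N \<ge> 1 \<Longrightarrow> psd (A N)"
    and diag: "\<And>i. (\<lambda>N. A N $ i $ i) \<longlonglongrightarrow> d i * cnj (d i)"
    and kl: "(\<lambda>N. A N $ k $ l) \<longlonglongrightarrow> d k * cnj (d l)"
    and nz: "d k \<noteq> 0" "d l \<noteq> 0"
  shows "(\<lambda>N. A N $ i $ k / cnj (d k) - A N $ i $ l / cnj (d l)) \<longlonglongrightarrow> 0"
proof -
  define w where "w = (1 / cnj (d k)) *s axis k 1 - (1 / cnj (d l)) *s axis l (1::complex)"
  have Aw: "(A N *v w) $ i = A N $ i $ k / cnj (d k) - A N $ i $ l / cnj (d l)" for N i
    by (simp add: w_def matrix_vector_mult_diff_distrib vector_scalar_commute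
        matrix_vector_mult_axis)
  have lk: "(\<lambda>N. A N $ l $ k) \<longlonglongrightarrow> d l * cnj (d k)"
  proof -
    have "(\<lambda>N. cnj (A N $ k $ l)) \<longlonglongrightarrow> d l * cnj (d k)"
      using tendsto_cnj[OF kl] by (simp add: mult.commute)
    \<comment> \<open>Nothing is assumed about \<open>A 0\<close>, so the symmetry is available only
      eventually.\<close>
    moreover have "\<forall>\<^sub>F N in sequentially. cnj (A N $ k $ l) = A N $ l $ k"
      using psd by (intro eventually_sequentiallyI[of 1]) (metis hermitian_entry psd_def)
    ultimately show ?thesis by (rule Lim_transform_eventually)
  qed
  have "cinner w x = x $ k / d k - x $ l / d l" for x
    by (simp add: w_def cinner_diff_left cinner_scale_left cinner_mult_axis)
  then have "cinner w (A N *v w) = (A N $ k $ k / cnj (d k) - A N $ k $ l / cnj (d l)) / d k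
      - (A N $ l $ k / cnj (d k) - A N $ l $ l / cnj (d l)) / d l" for N
    by (simp add: Aw)
  moreover have "(\<lambda>N. (A N $ k $ k / cnj (d k) - A N $ k $ l / cnj (d l)) / d k
      - (A N $ l $ k / cnj (d k) - A N $ l $ l / cnj (d l)) / d l) \<longlonglongrightarrow>
      (d k * cnj (d k) / cnj (d k) - d k * cnj (d l) / cnj (d l)) / d k
      - (d l * cnj (d k) / cnj (d k) - d l * cnj (d l) / cnj (d l)) / d l"
    by (intro tendsto_diff tendsto_divide tendsto_const diag kl lk) (use nz in auto)
  ultimately have "(\<lambda>N. cinner w (A N *v w)) \<longlonglongrightarrow>
      (d k * cnj (d k) / cnj (d k) - d k * cnj (d l) / cnj (d l)) / d k
      - (d l * cnj (d k) / cnj (d k) - d l * cnj (d l) / cnj (d l)) / d l"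
    by simp
  then have "(\<lambda>N. cinner w (A N *v w)) \<longlonglongrightarrow> 0" using nz by simp
  then have "(\<lambda>N. Re (A N $ i $ i) * Re (cinner w (A N *v w))) \<longlonglongrightarrow> Re (d i * cnj (d i)) * Re 0"
    by (intro tendsto_mult tendsto_Re diag)
  then have "(\<lambda>N. sqrt (Re (A N $ i $ i) * Re (cinner w (A N *v w)))) \<longlonglongrightarrow> 0"
    using tendsto_real_sqrt by fastforce
  moreover have "\<forall>\<^sub>F N in sequentially. norm ((A N *v w) $ i)
      \<le> sqrt (Re (A N $ i $ i) * Re (cinner w (A N *v w)))"
  proof (intro eventually_sequentiallyI[of 1] real_le_rsqrt)
    fix N :: nat assume "1 \<le> N"
    from psd_Cauchy_Schwarz[OF psd[OF this], of "axis i 1" w]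
    show "(norm ((A N *v w) $ i))\<^sup>2 \<le> Re (A N $ i $ i) * Re (cinner w (A N *v w))"
      by (simp add: cinner_mult_axis matrix_vector_mult_axis)
  qed
  ultimately have "(\<lambda>N. (A N *v w) $ i) \<longlonglongrightarrow> 0"
    by (rule Lim_null_comparison[rotated])
  then show ?thesis by (simp add: Aw)
qed

section \<open>Completing a rank-one limit along the cyclic off-diagonal\<close>

lemma of_int_mod_ring_add:
  "of_int_mod_ring (a + b) = (of_int_mod_ring a + of_int_mod_ring b :: 'n::finite mod_ring)"
  by transfer (simp add: mod_add_eq)

text \<open>Any \<open>x\<close> is reached from any \<open>y\<close> by adding the generator
  \<open>to_int_mod_ring (x - y)\<close> times. The generator \<open>of_int_mod_ring 1\<close> makes
  sense for every modulus and equals \<open>0\<close> when the group is trivial.\<close>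

lemma mod_ring_cyclic_induct:
  fixes x :: "'n::finite mod_ring"
  assumes "P y" "\<And>x. P x \<Longrightarrow> P (x + of_int_mod_ring 1)"
  shows "P x"
proof -
  have "P (y + of_int_mod_ring (int n))" for n
  proof (induction n)
    case (Suc n)
    have "y + of_int_mod_ring (int (Suc n)) = y + of_int_mod_ring (int n) + of_int_mod_ring 1"
      using of_int_mod_ring_add[where ?'n = 'n, of "int n" 1] by (simp add: add.assoc add.commute[of 1])
    then show ?case using assms(2)[OF Suc] by metis
  qed (use assms(1) in simp)
  moreover have "0 \<le> to_int_mod_ring (x - y)" by transfer simp
  ultimately show ?thesis by (metis add.commute diff_add_cancel nat_0_le of_int_mod_ring_to_int_mod_ring)
qed

text \<open>In row \<open>i\<close> the normalized entry \<open>A N $ i $ j / cnj (d j)\<close>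
  tends to \<open>d i\<close> at \<open>j = i\<close>, and the column step says that its limit does
  not change when \<open>j\<close> advances by one; going around the cycle covers all
  columns.\<close>

lemma psd_tendsto_outer_product:
  fixes A :: "nat \<Rightarrow> complex ^ 'n::finite mod_ring ^ 'n mod_ring"
  assumes psd: "\<And>N. N \<ge> 1 \<Longrightarrow> psd (A N)"
    and diag: "\<And>i. (\<lambda>N. A N $ i $ i) \<longlonglongrightarrow> d i * cnj (d i)"
    and next_diag: "\<And>i. (\<lambda>N. A N $ i $ (i + of_int_mod_ring 1))
      \<longlonglongrightarrow> d i * cnj (d (i + of_int_mod_ring 1))"
    and nz: "\<And>i. d i \<noteq> 0"
  shows "(\<lambda>N. A N $ i $ j) \<longlonglongrightarrow> d i * cnj (d j)"
proof -
  have "(\<lambda>N. A N $ i $ j / cnj (d j)) \<longlonglongrightarrow> d i"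
  proof (induction j rule: mod_ring_cyclic_induct[where y = i])
    case 1
    have "(\<lambda>N. A N $ i $ i / cnj (d i)) \<longlonglongrightarrow> d i * cnj (d i) / cnj (d i)"
      by (intro tendsto_divide diag tendsto_const) (simp add: nz)
    then show ?case by (simp add: nz)
  next
    case (2 j)
    show ?case
      using tendsto_diff[OF 2 psd_tendsto_column_step[OF psd diag next_diag nz nz], of i j]
      by simp
  qed
  then have "(\<lambda>N. A N $ i $ j / cnj (d j) * cnj (d j)) \<longlonglongrightarrow> d i * cnj (d j)"
    by (intro tendsto_mult tendsto_const)
  then show ?thesis by (simp add: nz)
qed

text \<open>No spectral gap enters. The Rayleigh quotient at \<open>d\<close> bounds
  \<open>mu\<close> from below, while \<open>mu \<le> c\<^sup>2 + e\<close> and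
  \<open>c \<le> norm d\<close> bound it from above, so both \<open>mu\<close> and
  \<open>c\<^sup>2\<close> are squeezed to \<open>(norm d)\<^sup>2\<close>. The squared distance to
  the rotated \<open>d\<close> is an explicit function of these two numbers.\<close>

lemma leading_eigenvector_tendsto:
  fixes A :: "nat \<Rightarrow> complex ^ 'k::finite ^ 'k"
  assumes psd: "\<And>N. N \<ge> 1 \<Longrightarrow> psd (A N)"
    and lim: "\<And>i j. (\<lambda>N. A N $ i $ j) \<longlonglongrightarrow> d $ i * cnj (d $ j)"
    and nz: "d \<noteq> 0"
    and mu: "\<And>N. N \<ge> 1 \<Longrightarrow> largest_eigenvalue (A N) (mu N)"
    and eig: "\<And>N. N \<ge> 1 \<Longrightarrow> A N *v u N = of_real (mu N) *s u N"
    and unit: "\<And>N. N \<ge> 1 \<Longrightarrow> norm (u N) = 1"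
  shows "(\<lambda>N. of_real (sqrt (mu N)) *s u N - exp (\<i> * of_real (Arg2pi (cinner d (u N)))) *s d)
    \<longlonglongrightarrow> 0"
proof -
  define E where "E N = A N - outer_product d" for N
  \<comment> \<open>Entries of a unit vector have modulus at most \<open>1\<close>, so this sum
    bounds the form of \<open>E N\<close> at \<open>u N\<close>.\<close>
  define e where "e N = (\<Sum>i\<in>UNIV. \<Sum>j\<in>UNIV. cmod (E N $ i $ j))" for N
  define c where "c N = cmod (cinner d (u N))" for N
  have "(\<lambda>N. E N $ i $ j) \<longlonglongrightarrow> 0" for i j
    using tendsto_diff[OF lim[of i j] tendsto_const[of "d $ i * cnj (d $ j)"]]
    by (simp add: E_def outer_product_def)
  then have e0: "e \<longlonglongrightarrow> 0"
    unfolding e_def by (intro tendsto_null_sum tendsto_norm_zero)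
  have mu_eq: "of_real (mu N) = cinner (u N) (A N *v u N)" if "N \<ge> 1" for N
    using that by (simp add: eig cinner_scale_right cinner_self unit)
  have mu_nonneg: "mu N \<ge> 0" if "N \<ge> 1" for N
    using psd[OF that] unfolding psd_def by (metis mu_eq[OF that] Re_complex_of_real)
  have mu_le: "mu N \<le> (c N)\<^sup>2 + e N" if N: "N \<ge> 1" for N
  proof -
    have "A N = outer_product d + E N" by (simp add: E_def)
    then have "of_real (mu N) = of_real ((c N)\<^sup>2) + cinner (u N) (E N *v u N)"
      by (simp add: mu_eq[OF N] matrix_vector_mult_add_rdistrib cinner_add_right
          cinner_outer_product c_def del: of_real_power)
    then have "mu N = (c N)\<^sup>2 + Re (cinner (u N) (E N *v u N))"
      by (metis Re_complex_of_real plus_complex.sel(1))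
    moreover have "cmod (cinner (u N) (E N *v u N)) \<le> e N"
    proof -
      have u1: "cmod (u N $ i) \<le> 1" for i
        using Finite_Cartesian_Product.norm_nth_le[of "u N" i] unit[OF N] by simp
      have "cinner (u N) (E N *v u N)
          = (\<Sum>i\<in>UNIV. \<Sum>j\<in>UNIV. cnj (u N $ i) * (E N $ i $ j * u N $ j))"
        by (simp add: cinner_def matrix_vector_mult_def sum_distrib_left)
      also have "cmod \<dots> \<le> e N"
        unfolding e_def
      proof (intro sum_norm_le)
        fix i j
        have "cmod (u N $ i) * (cmod (E N $ i $ j) * cmod (u N $ j)) \<le> 1 * (cmod (E N $ i $ j) * 1)"
          by (intro mult_mono u1) auto
        then show "cmod (cnj (u N $ i) * (E N $ i $ j * u N $ j)) \<le> cmod (E N $ i $ j)"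
          by (simp add: norm_mult)
      qed
      finally show ?thesis .
    qed
    ultimately show ?thesis using complex_Re_le_cmod[of "cinner (u N) (E N *v u N)"] by linarith
  qed
  have c_le: "c N \<le> norm d" if "N \<ge> 1" for N
    using cmod_cinner_le[of d "u N"] unit[OF that] by (simp add: c_def)
  have nd: "(norm d)\<^sup>2 > 0" using nz by simp
  have low: "(\<lambda>N. Re (cinner d (A N *v d)) / (norm d)\<^sup>2) \<longlonglongrightarrow> (norm d)\<^sup>2"
  proof -
    have "(\<lambda>N. cinner d (A N *v d)) \<longlonglongrightarrow> cinner d (outer_product d *v d)"
      unfolding cinner_def matrix_vector_mult_def outer_product_def vec_lambda_beta
      by (intro tendsto_intros lim)
    then have "(\<lambda>N. Re (cinner d (A N *v d)) / (norm d)\<^sup>2)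
        \<longlonglongrightarrow> Re (cinner d (outer_product d *v d)) / (norm d)\<^sup>2"
      using nz by (intro tendsto_intros) auto
    then show ?thesis
      using nz by (simp add: cinner_outer_product cinner_self power2_eq_square norm_mult)
  qed
  have mu_ge: "Re (cinner d (A N *v d)) / (norm d)\<^sup>2 \<le> mu N" if "N \<ge> 1" for N
    using largest_eigenvalue_ge_Rayleigh[OF _ mu[OF that], of d] psd[OF that] nd
    by (simp add: psd_def field_simps)
  have mu_lim: "mu \<longlonglongrightarrow> (norm d)\<^sup>2"
  proof (rule tendsto_sandwich[OF _ _ low])
    show "\<forall>\<^sub>F N in sequentially. Re (cinner d (A N *v d)) / (norm d)\<^sup>2 \<le> mu N"
      using mu_ge by (intro eventually_sequentiallyI[of 1])
    have "mu N \<le> (norm d)\<^sup>2 + e N" if "N \<ge> 1" for N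
    proof -
      have "(c N)\<^sup>2 \<le> (norm d)\<^sup>2" using c_le[OF that] by (intro power_mono) (simp_all add: c_def)
      then show ?thesis using mu_le[OF that] by linarith
    qed
    then show "\<forall>\<^sub>F N in sequentially. mu N \<le> (norm d)\<^sup>2 + e N"
      by (intro eventually_sequentiallyI[of 1])
    show "(\<lambda>N. (norm d)\<^sup>2 + e N) \<longlonglongrightarrow> (norm d)\<^sup>2"
      using tendsto_add[OF tendsto_const e0] by simp
  qed
  have c2_lim: "(\<lambda>N. (c N)\<^sup>2) \<longlonglongrightarrow> (norm d)\<^sup>2"
  proof (rule tendsto_sandwich)
    show "\<forall>\<^sub>F N in sequentially. mu N - e N \<le> (c N)\<^sup>2"
      using mu_le by (intro eventually_sequentiallyI[of 1]) (simp add: algebra_simps)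
    show "\<forall>\<^sub>F N in sequentially. (c N)\<^sup>2 \<le> (norm d)\<^sup>2"
      using c_le by (intro eventually_sequentiallyI[of 1] power_mono) (simp_all add: c_def)
    show "(\<lambda>N. mu N - e N) \<longlonglongrightarrow> (norm d)\<^sup>2"
      using tendsto_diff[OF mu_lim e0] by simp
  qed simp
  have c_lim: "c \<longlonglongrightarrow> norm d"
    using tendsto_real_sqrt[OF c2_lim] by (simp add: c_def[abs_def])
  define x where
    "x N = of_real (sqrt (mu N)) *s u N - exp (\<i> * of_real (Arg2pi (cinner d (u N)))) *s d" for N
  have nx: "(norm (x N))\<^sup>2 = mu N + (norm d)\<^sup>2 - 2 * sqrt (mu N) * c N" if N: "N \<ge> 1" for N
  proof -
    \<comment> \<open>Rotating \<open>d\<close> by the phase of \<open>cinner d (u N)\<close> turns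
      both cross terms into the real number \<open>sqrt (mu N) * c N\<close>. If
      \<open>c N = 0\<close>, the factorization below holds with any phase.\<close>
    define \<theta> where "\<theta> = exp (\<i> * of_real (Arg2pi (cinner d (u N))))"
    have z: "cinner d (u N) = of_real (c N) * \<theta>"
      using Arg2pi_eq[of "cinner d (u N)"] by (simp add: \<theta>_def c_def)
    have z': "cinner (u N) d = of_real (c N) * cnj \<theta>"
      by (metis z cnj_cinner complex_cnj_mult complex_cnj_complex_of_real)
    have th: "cnj \<theta> * \<theta> = 1" by (simp add: \<theta>_def exp_cnj flip: exp_add)
    have sq: "of_real (sqrt (mu N)) * of_real (sqrt (mu N)) = (of_real (mu N) :: complex)"
      using mu_nonneg[OF N] by (simp flip: of_real_mult)
    have xN: "x N = of_real (sqrt (mu N)) *s u N - \<theta> *s d" by (simp add: x_def \<theta>_def)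
    have "cinner (x N) (x N) = of_real (sqrt (mu N)) * of_real (sqrt (mu N))
        - of_real (sqrt (mu N)) * of_real (c N) * (cnj \<theta> * \<theta>)
        - of_real (sqrt (mu N)) * of_real (c N) * (cnj \<theta> * \<theta>)
        + (cnj \<theta> * \<theta>) * of_real ((norm d)\<^sup>2)"
      unfolding xN cinner_diff_left cinner_diff_right cinner_scale_left cinner_scale_right z z'
      unfolding cinner_self unit[OF N] by (simp add: algebra_simps)
    then have "of_real ((norm (x N))\<^sup>2)
        = (of_real (mu N + (norm d)\<^sup>2 - 2 * sqrt (mu N) * c N) :: complex)"
      unfolding th sq cinner_self by simp
    then show ?thesis by (simp only: of_real_eq_iff)
  qed
  have "(\<lambda>N. mu N + (norm d)\<^sup>2 - 2 * sqrt (mu N) * c N)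
      \<longlonglongrightarrow> (norm d)\<^sup>2 + (norm d)\<^sup>2 - 2 * sqrt ((norm d)\<^sup>2) * norm d"
    by (intro tendsto_intros mu_lim c_lim)
  then have "(\<lambda>N. mu N + (norm d)\<^sup>2 - 2 * sqrt (mu N) * c N) \<longlonglongrightarrow> 0"
    by (simp add: power2_eq_square)
  moreover have "\<forall>\<^sub>F N in sequentially. mu N + (norm d)\<^sup>2 - 2 * sqrt (mu N) * c N = (norm (x N))\<^sup>2"
    using nx by (intro eventually_sequentiallyI[of 1]) simp
  ultimately have "(\<lambda>N. (norm (x N))\<^sup>2) \<longlonglongrightarrow> 0"
    by (rule Lim_transform_eventually)
  from tendsto_real_sqrt[OF this] have "x \<longlonglongrightarrow> 0"
    by (subst tendsto_norm_zero_iff[symmetric]) simp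
  then show ?thesis by (simp add: x_def[abs_def])
qed

section \<open>Limits of the least squares minimizers\<close>

lemma ls_residual_le_objective:
  "(cmod (T k1 (k1 + m) (k2 + m) - G (k2 - k1) $ k1 $ (k1 + m) - G m $ k1 $ k2))\<^sup>2
    \<le> ls_objective T G"
proof -
  let ?f = "\<lambda>k1 k2 m. (cmod (T k1 (k1 + m) (k2 + m) - G (k2 - k1) $ k1 $ (k1 + m) - G m $ k1 $ k2))\<^sup>2"
  have "?f k1 k2 m \<le> (\<Sum>m\<in>UNIV. ?f k1 k2 m)"
    by (rule member_le_sum) auto
  also have "\<dots> \<le> (\<Sum>k2\<in>UNIV. \<Sum>m\<in>UNIV. ?f k1 k2 m)"
    by (rule member_le_sum[of k2 UNIV "\<lambda>k2. \<Sum>m\<in>UNIV. ?f k1 k2 m"]) (auto intro: sum_nonneg)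
  also have "\<dots> \<le> (\<Sum>k1\<in>UNIV. \<Sum>k2\<in>UNIV. \<Sum>m\<in>UNIV. ?f k1 k2 m)"
    by (rule member_le_sum[of k1 UNIV "\<lambda>k1. \<Sum>k2\<in>UNIV. \<Sum>m\<in>UNIV. ?f k1 k2 m"])
       (auto intro!: sum_nonneg)
  finally show ?thesis unfolding ls_objective_def .
qed

lemma ls_minimizer_tendsto:
  fixes S :: "'n::finite mod_ring \<Rightarrow> 'n mod_ring \<Rightarrow> complex"
  assumes herm: "\<And>i j. S j i = cnj (S i j)"
    and nz: "\<And>i j. i \<noteq> j \<Longrightarrow> S i j \<noteq> 0"
    and p: "\<And>k. (\<lambda>N. p N $ k) \<longlonglongrightarrow> Re (S k k)"
    and T: "\<And>k1 k2 m. (\<lambda>N. T N k1 (k1 + m) (k2 + m)) \<longlonglongrightarrow>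
      S k1 (k1 + m) * cnj (S k2 (k2 + m)) + S k1 k2 * cnj (S (k1 + m) (k2 + m))"
    and min: "\<And>N. N \<ge> 1 \<Longrightarrow> ls_minimizer (p N) (T N) (G N)"
    and m: "m \<noteq> 0"
  shows "(\<lambda>N. G N m $ i $ j) \<longlonglongrightarrow> S i (i + m) * cnj (S j (j + m))"
proof -
  \<comment> \<open>The competitor. Feasibility forces its component at \<open>0\<close> to be built
    from \<open>p N\<close>, so it depends on \<open>N\<close> and its objective need not vanish but
    only tends to \<open>0\<close>.\<close>
  define F where "F N m = (if m = 0 then \<chi> i j. of_real (p N $ i * p N $ j)
      else outer_product (\<chi> k. S k (k + m)))" for N m
  have F: "ls_feasible (p N) (F N)" for N
    by (simp add: ls_feasible_def F_def psd_outer_product)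
  have "of_real (Re (S k k)) = S k k" for k
    using herm[of k k] by (metis Reals_cnj_iff of_real_Re)
  then have S0: "of_real (Re (S i i) * Re (S j j)) = S i (i + 0) * cnj (S j (j + 0))" for i j
    using herm[of j j] by simp
  have G0: "(\<lambda>N. G N 0 $ i $ j) \<longlonglongrightarrow> S i (i + 0) * cnj (S j (j + 0))" for i j
  proof -
    have "(\<lambda>N. of_real (p N $ i * p N $ j)) \<longlonglongrightarrow> S i (i + 0) * cnj (S j (j + 0))"
      unfolding S0[symmetric] by (intro tendsto_of_real tendsto_mult p)
    moreover have "\<forall>\<^sub>F N in sequentially. of_real (p N $ i * p N $ j) = G N 0 $ i $ j"
      using min by (intro eventually_sequentiallyI[of 1]) (simp add: ls_minimizer_def ls_feasible_def)
    ultimately show ?thesis by (rule Lim_transform_eventually)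
  qed
  have F_lim: "(\<lambda>N. F N m $ i $ j) \<longlonglongrightarrow> S i (i + m) * cnj (S j (j + m))" for m i j
  proof (cases "m = 0")
    case True
    have "(\<lambda>N. of_real (p N $ i * p N $ j)) \<longlonglongrightarrow> S i (i + 0) * cnj (S j (j + 0))"
      unfolding S0[symmetric] by (intro tendsto_of_real tendsto_mult p)
    then show ?thesis by (simp add: True F_def)
  qed (simp add: F_def outer_product_def)
  define R where "R H k1 k2 m N = T N k1 (k1 + m) (k2 + m) - H N (k2 - k1) $ k1 $ (k1 + m)
      - H N m $ k1 $ k2" for H k1 k2 m N
  have RF: "R F k1 k2 m \<longlonglongrightarrow> 0" for k1 k2 m
  proof -
    \<comment> \<open>At index \<open>k2 - k1\<close> and position \<open>(k1, k1 + m)\<close> the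
      rank-one limit is the second product in the limit of \<open>T\<close>; the two matrices in one
      residual thus account for both Gaussian pairings.\<close>
    have *: "k1 + (k2 - k1) = k2" "k1 + m + (k2 - k1) = k2 + m"
      by (simp_all add: algebra_simps)
    have "R F k1 k2 m \<longlonglongrightarrow>
        S k1 (k1 + m) * cnj (S k2 (k2 + m)) + S k1 k2 * cnj (S (k1 + m) (k2 + m))
        - S k1 (k1 + (k2 - k1)) * cnj (S (k1 + m) (k1 + m + (k2 - k1)))
        - S k1 (k1 + m) * cnj (S k2 (k2 + m))"
      unfolding R_def by (intro tendsto_diff T F_lim)
    then show ?thesis unfolding * by simp
  qed
  have obj: "(\<lambda>N. ls_objective (T N) (F N)) \<longlonglongrightarrow> 0"
    unfolding ls_objective_def
    using RF by (intro tendsto_null_sum tendsto_null_power tendsto_norm_zero) (simp_all add: R_def[abs_def])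
  have RG: "R G k1 k2 m \<longlonglongrightarrow> 0" for k1 k2 m
  proof (rule Lim_null_comparison)
    show "(\<lambda>N. sqrt (ls_objective (T N) (F N))) \<longlonglongrightarrow> 0"
      using tendsto_real_sqrt[OF obj] by simp
    have "norm (R G k1 k2 m N) \<le> sqrt (ls_objective (T N) (F N))" if "N \<ge> 1" for N
    proof (rule real_le_rsqrt)
      have "(norm (R G k1 k2 m N))\<^sup>2 \<le> ls_objective (T N) (G N)"
        unfolding R_def by (rule ls_residual_le_objective)
      also have "\<dots> \<le> ls_objective (T N) (F N)"
        using min[OF that] F unfolding ls_minimizer_def by blast
      finally show "(norm (R G k1 k2 m N))\<^sup>2 \<le> ls_objective (T N) (F N)" .
    qed
    then show "\<forall>\<^sub>F N in sequentially. norm (R G k1 k2 m N) \<le> sqrt (ls_objective (T N) (F N))"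
      by (intro eventually_sequentiallyI[of 1])
  qed
  have GG: "(\<lambda>N. G N (k2 - k1) $ k1 $ (k1 + m) + G N m $ k1 $ k2) \<longlonglongrightarrow>
      S k1 (k1 + m) * cnj (S k2 (k2 + m)) + S k1 k2 * cnj (S (k1 + m) (k2 + m))" for k1 k2 m
    using tendsto_diff[OF T RG, of k1 m k2 k1 k2 m] by (simp add: R_def)
  \<comment> \<open>For \<open>k2 = k1\<close> the other matrix in the equation is
    \<open>G N 0\<close>, which the constraint fixes.\<close>
  have diag: "(\<lambda>N. G N m $ k $ k) \<longlonglongrightarrow> S k (k + m) * cnj (S k (k + m))" for m k
    using tendsto_diff[OF GG[where ?k1.0 = k and ?k2.0 = k and m = m] G0[of k "k + m"]] by simp
  \<comment> \<open>For \<open>k2 = k1 + m\<close> both terms are the same entry, hence the factor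
    \<open>1/2\<close>.\<close>
  have diag_m: "(\<lambda>N. G N m $ k $ (k + m)) \<longlonglongrightarrow> S k (k + m) * cnj (S (k + m) (k + m + m))" for m k
    using tendsto_mult[OF GG[where ?k1.0 = k and ?k2.0 = "k + m" and m = m] tendsto_const[of "1/2"]]
    by simp
  define g :: "'n mod_ring" where "g = of_int_mod_ring 1"
  \<comment> \<open>The existence of a nonzero \<open>m\<close> excludes the trivial group.\<close>
  have "g \<noteq> 0"
  proof
    assume "g = 0"
    then have "m = 0"
      by (intro mod_ring_cyclic_induct[of "\<lambda>x. x = 0" 0 m]) (auto simp: g_def)
    then show False using m by simp
  qed
  have psd: "psd (G N m)" if "m \<noteq> 0" "N \<ge> 1" for N m
    using min[OF that(2)] that(1) by (simp add: ls_minimizer_def ls_feasible_def)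
  have G_g: "(\<lambda>N. G N g $ i $ j) \<longlonglongrightarrow> S i (i + g) * cnj (S j (j + g))" for i j
    by (rule psd_tendsto_outer_product[where d = "\<lambda>i. S i (i + g)"])
       (use psd diag diag_m nz \<open>g \<noteq> 0\<close> in \<open>auto simp flip: g_def\<close>)
  \<comment> \<open>Here the equation pairs the wanted entry \<open>(i, i + g)\<close> of
    \<open>G N m\<close> with the entry \<open>(i, i + m)\<close> of \<open>G N g\<close>, whose
    limit \<open>G_g\<close> has just been found.\<close>
  have "(\<lambda>N. G N m $ i $ (i + g)) \<longlonglongrightarrow> S i (i + m) * cnj (S (i + g) (i + g + m))" for i
  proof -
    have "(\<lambda>N. G N g $ i $ (i + m) + G N m $ i $ (i + g)) \<longlonglongrightarrow>
        S i (i + m) * cnj (S (i + g) (i + g + m)) + S i (i + g) * cnj (S (i + m) (i + g + m))"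
      using GG[where ?k1.0 = i and ?k2.0 = "i + g" and m = m] unfolding add_diff_cancel_left' .
    moreover have "(\<lambda>N. G N g $ i $ (i + m)) \<longlonglongrightarrow> S i (i + g) * cnj (S (i + m) (i + (g + m)))"
      using G_g[of i "i + m"] unfolding add.assoc add.commute[of m g] .
    ultimately have "(\<lambda>N. (G N g $ i $ (i + m) + G N m $ i $ (i + g)) - G N g $ i $ (i + m))
        \<longlonglongrightarrow> (S i (i + m) * cnj (S (i + g) (i + g + m)) + S i (i + g) * cnj (S (i + m) (i + g + m)))
          - S i (i + g) * cnj (S (i + m) (i + (g + m)))"
      by (rule tendsto_diff)
    then show ?thesis by (simp add: add.assoc)
  qed
  note next_diag = this
  show ?thesis
    by (rule psd_tendsto_outer_product[where d = "\<lambda>i. S i (i + m)"])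
       (use psd diag next_diag nz m in \<open>auto simp flip: g_def\<close>)
qed

text \<open>
  The noise only enters the diagonal of \<open>S\<close>, whereas the rank-one limits for \<open>m \<noteq> 0\<close> involve only
  off-diagonal entries of \<open>S\<close>.
\<close>

theorem phase_error_tendsto:
  fixes \<Sigma> :: "complex ^ 'n::finite mod_ring ^ 'n mod_ring" and sigma2 :: real
  defines "S \<equiv> \<lambda>i j. \<Sigma> $ i $ j + (if i = j then of_real sigma2 else 0)"
  assumes herm: "\<And>i j. \<Sigma> $ j $ i = cnj (\<Sigma> $ i $ j)"
    and nz: "\<And>i j. \<Sigma> $ i $ j \<noteq> 0"
    and p: "\<And>k. (\<lambda>N. power_spectrum_est N y $ k) \<longlonglongrightarrow> Re (S k k)"
    and T: "\<And>k1 k2 m. (\<lambda>N. trispectrum_est N y k1 (k1 + m) (k2 + m)) \<longlonglongrightarrow>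
      S k1 (k1 + m) * cnj (S k2 (k2 + m)) + S k1 k2 * cnj (S (k1 + m) (k2 + m))"
    and est: "\<And>N. N \<ge> 1 \<Longrightarrow> covariance_estimate sigma2 N y (C N)"
  shows "(\<lambda>N. phase_error (C N) \<Sigma>) \<longlonglongrightarrow> 0"
proof -
  \<comment> \<open>The condition \<open>N \<ge> 1\<close> stands inside the existential so that
    witnesses can be chosen for all \<open>N\<close> at once.\<close>
  have "\<forall>N. \<exists>G mu u. N \<ge> 1 \<longrightarrow>
      ls_minimizer (power_spectrum_est N y) (trispectrum_est N y) G \<and>
      (\<forall>m. m \<noteq> 0 \<longrightarrow>
         largest_eigenvalue (G m) (mu m) \<and> G m *v u m = of_real (mu m) *s u m \<and> norm (u m) = 1) \<and>
      C N = (\<chi> k1 k2.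
             if k2 - k1 = 0 then of_real (power_spectrum_est N y $ k1 - sigma2)
             else (of_real (sqrt (mu (k2 - k1))) *s u (k2 - k1)) $ k1)"
    using est unfolding covariance_estimate_def by auto
  from this[unfolded choice_iff] obtain G mu u where all: "\<forall>N. N \<ge> 1 \<longrightarrow>
      ls_minimizer (power_spectrum_est N y) (trispectrum_est N y) (G N) \<and>
      (\<forall>m. m \<noteq> 0 \<longrightarrow> largest_eigenvalue (G N m) (mu N m) \<and>
         G N m *v u N m = of_real (mu N m) *s u N m \<and> norm (u N m) = 1) \<and>
      C N = (\<chi> k1 k2.
             if k2 - k1 = 0 then of_real (power_spectrum_est N y $ k1 - sigma2)
             else (of_real (sqrt (mu N (k2 - k1))) *s u N (k2 - k1)) $ k1)"
    by (elim exE) rule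
  have min: "ls_minimizer (power_spectrum_est N y) (trispectrum_est N y) (G N)" if "N \<ge> 1" for N
    using all that by blast
  have lead: "largest_eigenvalue (G N m) (mu N m)"
    and eig: "G N m *v u N m = of_real (mu N m) *s u N m"
    and unit: "norm (u N m) = 1" if "N \<ge> 1" "m \<noteq> 0" for N m
    using all that by blast+
  have C: "C N = (\<chi> k1 k2.
             if k2 - k1 = 0 then of_real (power_spectrum_est N y $ k1 - sigma2)
             else (of_real (sqrt (mu N (k2 - k1))) *s u N (k2 - k1)) $ k1)" if "N \<ge> 1" for N
    using all that by blast
  have hermS: "S j i = cnj (S i j)" for i j by (simp add: S_def herm[of j i])
  have nzS: "S i j \<noteq> 0" if "i \<noteq> j" for i j using that nz by (simp add: S_def)
  define d where "d m = (\<chi> k. \<Sigma> $ k $ (k + m))" for m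
  have S_d: "S k (k + m) = d m $ k" if "m \<noteq> 0" for k m using that by (simp add: S_def d_def)
  \<comment> \<open>\<open>Arg2pi\<close> has values in \<open>[0, 2 * pi)\<close>, so these phases
    are admissible and their error bounds the infimum from above.\<close>
  define \<phi> where "\<phi> N m = Arg2pi (cinner (d m) (u N m))" for N m
  define X where "X N m = of_real (sqrt (mu N m)) *s u N m - exp (\<i> * of_real (\<phi> N m)) *s d m" for N m
  have X: "(\<lambda>N. X N m) \<longlonglongrightarrow> 0" if m: "m \<noteq> 0" for m
    unfolding X_def \<phi>_def
  proof (rule leading_eigenvector_tendsto)
    show "psd (G N m)" if "N \<ge> 1" for N
      using min[OF that] m by (simp add: ls_minimizer_def ls_feasible_def)
    show "(\<lambda>N. G N m $ i $ j) \<longlonglongrightarrow> d m $ i * cnj (d m $ j)" for i j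
      using ls_minimizer_tendsto[of S, OF hermS nzS p T min m, of i j] by (simp add: S_d m)
    show "d m \<noteq> 0" using nz by (auto simp: d_def vec_eq_iff)
  qed (use lead eig unit m in auto)
  define W where "W N = C N - hadamard \<Sigma> (circulant (phase_vector (\<phi> N)))" for N
  have "(\<lambda>N. W N $ k1 $ k2) \<longlonglongrightarrow> 0" for k1 k2
  proof (cases "k1 = k2")
    case True
    \<comment> \<open>The power spectrum only sees a real part; the diagonal of a Hermitian matrix
      is real, and subtracting \<open>sigma2\<close> removes the noise.\<close>
    have "\<Sigma> $ k1 $ k1 = of_real (Re (S k1 k1) - sigma2)"
      using herm[of k1 k1] by (simp add: S_def complex_eq_iff)
    then have "(\<lambda>N. of_real (power_spectrum_est N y $ k1 - sigma2) - \<Sigma> $ k1 $ k1)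
        \<longlonglongrightarrow> \<Sigma> $ k1 $ k1 - \<Sigma> $ k1 $ k1"
      using tendsto_of_real[OF tendsto_diff[OF p[of k1] tendsto_const[of sigma2]], where ?'a = complex]
      by (intro tendsto_diff tendsto_const) simp
    moreover have "\<forall>\<^sub>F N in sequentially.
        of_real (power_spectrum_est N y $ k1 - sigma2) - \<Sigma> $ k1 $ k1 = W N $ k1 $ k2"
      using True by (intro eventually_sequentiallyI[of 1])
        (simp add: W_def C hadamard_def circulant_def phase_vector_def)
    ultimately show ?thesis by (simp add: Lim_transform_eventually)
  next
    case False
    then have ne: "k2 - k1 \<noteq> 0" by simp
    have "k1 + (k2 - k1) = k2" by (simp add: algebra_simps)
    then have "\<forall>\<^sub>F N in sequentially. X N (k2 - k1) $ k1 = W N $ k1 $ k2"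
      using ne by (intro eventually_sequentiallyI[of 1])
        (simp add: W_def C X_def d_def hadamard_def circulant_def phase_vector_def mult.commute)
    with tendsto_vec_nth[OF X[OF ne], of k1] show ?thesis
      by (simp add: Lim_transform_eventually)
  qed
  then have "W \<longlonglongrightarrow> 0"
    by (intro vec_tendstoI) simp
  then have nW: "(\<lambda>N. norm (W N)) \<longlonglongrightarrow> 0" by (rule tendsto_norm_zero)
  have "phase_error (C N) \<Sigma> \<le> norm (W N)" for N
    unfolding phase_error_def W_def
    by (intro cINF_lower bdd_belowI2[of _ 0])
       (auto simp: \<phi>_def Arg2pi_ge_0 Arg2pi_lt_2pi)
  moreover have "0 \<le> phase_error (C N) \<Sigma>" for N
    using phase_error_attained[of "C N" \<Sigma>] by auto
  ultimately show ?thesis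
    by (intro tendsto_sandwich[OF _ _ tendsto_const nW]) auto
qed

section \<open>A strong law of large numbers\<close>

text \<open>By monotone convergence the pointwise series has finite integral, so it is finite almost
  everywhere and its terms vanish. This does the work of the Borel-Cantelli lemma.\<close>

lemma AE_tendsto_0_of_summable_integral:
  fixes W :: "nat \<Rightarrow> 'a \<Rightarrow> real"
  assumes int: "\<And>n. integrable M (W n)" and nonneg: "\<And>n x. 0 \<le> W n x"
    and sum: "summable (\<lambda>n. integral\<^sup>L M (W n))"
  shows "AE x in M. (\<lambda>n. W n x) \<longlonglongrightarrow> 0"
proof -
  have [measurable]: "W n \<in> borel_measurable M" for n using int by auto
  have "(\<integral>\<^sup>+x. (\<Sum>n. ennreal (W n x)) \<partial>M) = (\<Sum>n. \<integral>\<^sup>+x. ennreal (W n x) \<partial>M)"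
    by (rule nn_integral_suminf) measurable
  also have "\<dots> = (\<Sum>n. ennreal (integral\<^sup>L M (W n)))"
    using int nonneg by (simp add: nn_integral_eq_integral)
  also have "\<dots> = ennreal (\<Sum>n. integral\<^sup>L M (W n))"
    using sum nonneg by (intro suminf_ennreal2) (auto intro: Bochner_Integration.integral_nonneg)
  finally have "(\<integral>\<^sup>+x. (\<Sum>n. ennreal (W n x)) \<partial>M) \<noteq> \<infinity>" by simp
  then have "AE x in M. (\<Sum>n. ennreal (W n x)) \<noteq> \<infinity>"
    by (intro nn_integral_PInf_AE) measurable
  then show ?thesis
  proof eventually_elim
    case (elim x)
    have "summable (\<lambda>n. W n x)"
      using nonneg elim by (intro summable_suminf_not_top) auto
    then show ?case by (rule summable_LIMSEQ_zero)
  qed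
qed

text \<open>\<open>N\<close> lies between the consecutive squares \<open>(Suc n)\<^sup>2\<close> and
  \<open>(n + 2)\<^sup>2\<close>; the terms past the lower square are bounded by their total
  variation up to the upper one. The shift by one in \<open>n\<close> keeps the divisor
  \<open>(Suc n)\<^sup>2\<close> positive for every \<open>n\<close>.\<close>

lemma average_le_of_squares:
  fixes x :: "nat \<Rightarrow> real"
  assumes "N \<ge> 1"
  defines "n \<equiv> floor_sqrt N - 1"
  shows "\<bar>(\<Sum>i=1..N. x i) / N\<bar> \<le> \<bar>\<Sum>i=1..(Suc n)\<^sup>2. x i\<bar> / (Suc n)\<^sup>2
    + (\<Sum>i\<in>{(Suc n)\<^sup>2<..(n + 2)\<^sup>2}. \<bar>x i\<bar>) / (Suc n)\<^sup>2"
proof -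
  have n: "Suc n = floor_sqrt N"
    using assms by (simp add: n_def Suc_leI)
  have le: "(Suc n)\<^sup>2 \<le> N" and lt: "N \<le> (n + 2)\<^sup>2"
    unfolding n using Suc_floor_sqrt_power2_gt[of N] n by simp_all
  have pos: "(Suc n)\<^sup>2 > 0" by simp
  have "{1..N} = {1..(Suc n)\<^sup>2} \<union> {(Suc n)\<^sup>2<..N}" using le pos by auto
  then have "(\<Sum>i=1..N. x i) = (\<Sum>i=1..(Suc n)\<^sup>2. x i) + (\<Sum>i\<in>{(Suc n)\<^sup>2<..N}. x i)"
    by (simp only:) (rule sum.union_disjoint, auto)
  moreover have "\<bar>\<Sum>i\<in>{(Suc n)\<^sup>2<..N}. x i\<bar> \<le> (\<Sum>i\<in>{(Suc n)\<^sup>2<..(n + 2)\<^sup>2}. \<bar>x i\<bar>)"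
    using lt by (intro order_trans[OF sum_abs] sum_mono2) auto
  ultimately have "\<bar>\<Sum>i=1..N. x i\<bar> \<le> \<bar>\<Sum>i=1..(Suc n)\<^sup>2. x i\<bar>
      + (\<Sum>i\<in>{(Suc n)\<^sup>2<..(n + 2)\<^sup>2}. \<bar>x i\<bar>)" (is "_ \<le> ?R")
    by linarith
  then have "\<bar>(\<Sum>i=1..N. x i) / N\<bar> \<le> ?R / N"
    by (simp add: divide_right_mono)
  also have "\<dots> \<le> ?R / (Suc n)\<^sup>2"
    using le pos assms(1) by (intro divide_left_mono mult_pos_pos) (auto intro!: add_nonneg_nonneg sum_nonneg
        simp del: of_nat_power of_nat_Suc simp: of_nat_le_iff)
  finally show ?thesis by (simp add: add_divide_distrib)
qed

lemma filterlim_floor_sqrt_minus_1: "filterlim (\<lambda>N. floor_sqrt N - 1) at_top at_top"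
  unfolding filterlim_at_top
proof
  fix K
  have "K \<le> floor_sqrt N - 1" if "N \<ge> (K + 1)\<^sup>2" for N
    using le_floor_sqrtI[OF that] by simp
  then show "\<forall>\<^sub>F N in at_top. K \<le> floor_sqrt N - 1"
    by (rule eventually_sequentiallyI)
qed

text \<open>
  Chebyshev's bound makes the averages over the first \<open>n\<^sup>2\<close> terms summably small in \<open>L\<^sup>2\<close>, and the
  same holds for the total variation of the partial sums between \<open>n\<^sup>2\<close> and \<open>(n + 1)\<^sup>2\<close>.
\<close>

lemma (in prob_space) strong_law_uncorrelated:
  fixes X :: "nat \<Rightarrow> 'a \<Rightarrow> real"
  assumes meas: "\<And>i. i \<ge> 1 \<Longrightarrow> X i \<in> borel_measurable M"
    and sq: "\<And>i. i \<ge> 1 \<Longrightarrow> integrable M (\<lambda>x. (X i x)\<^sup>2)"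
    and bound: "\<And>i. i \<ge> 1 \<Longrightarrow> expectation (\<lambda>x. (X i x)\<^sup>2) \<le> B"
    and orth: "\<And>i j. i \<ge> 1 \<Longrightarrow> j \<ge> 1 \<Longrightarrow> i \<noteq> j \<Longrightarrow> expectation (\<lambda>x. X i x * X j x) = 0"
  shows "AE x in M. (\<lambda>N. (\<Sum>i=1..N. X i x) / N) \<longlonglongrightarrow> 0"
proof -
  have B: "B \<ge> 0" using order_trans[OF Bochner_Integration.integral_nonneg bound[of 1]] by simp
  have prod: "integrable M (\<lambda>x. X i x * X j x)" if "i \<ge> 1" "j \<ge> 1" for i j
  proof (rule Bochner_Integration.integrable_bound)
    show "integrable M (\<lambda>x. (X i x)\<^sup>2 + (X j x)\<^sup>2)" using sq that by simp
    have "\<bar>a * b\<bar> \<le> a\<^sup>2 + b\<^sup>2" for a b :: real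
      using sum_squares_bound[of "\<bar>a\<bar>" "\<bar>b\<bar>"] mult_nonneg_nonneg[of "\<bar>a\<bar>" "\<bar>b\<bar>"]
      unfolding abs_mult mult.assoc power2_abs by linarith
    then show "AE x in M. norm (X i x * X j x) \<le> norm ((X i x)\<^sup>2 + (X j x)\<^sup>2)" by simp
  qed (use meas that in measurable)
  define V where "V n x = ((\<Sum>i=1..(Suc n)\<^sup>2. X i x) / (Suc n)\<^sup>2)\<^sup>2" for n x
  define W where "W n x = ((\<Sum>i\<in>{(Suc n)\<^sup>2<..(n + 2)\<^sup>2}. \<bar>X i x\<bar>) / (Suc n)\<^sup>2)\<^sup>2" for n x
  have square_sum: "(\<Sum>i\<in>I. X i x)\<^sup>2 = (\<Sum>i\<in>I. \<Sum>j\<in>I. X i x * X j x)" for I x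
    by (simp add: power2_eq_square sum_product)
  have summable_B: "summable (\<lambda>n. K / real ((Suc n)\<^sup>2))" for K
  proof -
    have "summable (\<lambda>n. inverse (real (Suc n) ^ 2))"
      by (subst summable_Suc_iff) (rule inverse_power_summable, simp)
    from summable_mult[OF this, of K] show ?thesis by (simp add: divide_inverse)
  qed
  have V_int: "integrable M (V n)" for n
    unfolding V_def power_divide square_sum by (intro integrable_divide_zero Bochner_Integration.integrable_sum prod) auto
  have EV: "expectation (V n) \<le> B / (Suc n)\<^sup>2" for n
  proof -
    let ?I = "{1..(Suc n)\<^sup>2}"
    have "expectation (\<lambda>x. (\<Sum>i\<in>?I. X i x)\<^sup>2) = (\<Sum>i\<in>?I. expectation (\<lambda>x. \<Sum>j\<in>?I. X i x * X j x))"
      unfolding square_sum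
      by (intro Bochner_Integration.integral_sum Bochner_Integration.integrable_sum prod) auto
    also have "\<dots> = (\<Sum>i\<in>?I. \<Sum>j\<in>?I. expectation (\<lambda>x. X i x * X j x))"
      by (intro sum.cong refl Bochner_Integration.integral_sum prod) auto
    also have "\<dots> = (\<Sum>i\<in>?I. \<Sum>j\<in>?I. if i = j then expectation (\<lambda>x. (X i x)\<^sup>2) else 0)"
      by (intro sum.cong) (auto simp: orth power2_eq_square)
    also have "\<dots> = (\<Sum>i\<in>?I. expectation (\<lambda>x. (X i x)\<^sup>2))" by (simp add: sum.delta)
    also have "\<dots> \<le> (\<Sum>i\<in>?I. B)" by (intro sum_mono bound) auto
    finally have "expectation (\<lambda>x. (\<Sum>i\<in>?I. X i x)\<^sup>2) \<le> real ((Suc n)\<^sup>2) * B" by simp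
    then have "expectation (V n) \<le> real ((Suc n)\<^sup>2) * B / (real ((Suc n)\<^sup>2))\<^sup>2"
      unfolding V_def power_divide by (simp add: divide_right_mono del: of_nat_power of_nat_Suc)
    also have "\<dots> = B / (Suc n)\<^sup>2" by (simp add: power2_eq_square)
    finally show ?thesis .
  qed
  have V_nonneg: "0 \<le> V n x" for n x by (simp add: V_def)
  have "summable (\<lambda>n. expectation (V n))"
  proof (rule summable_comparison_test'[OF summable_B])
    show "norm (expectation (V n)) \<le> B / real ((Suc n)\<^sup>2)" for n
      using EV[of n] Bochner_Integration.integral_nonneg[of M "V n"] V_nonneg
      by (simp del: of_nat_Suc of_nat_power)
  qed
  then have V_lim: "AE x in M. (\<lambda>n. V n x) \<longlonglongrightarrow> 0"
    by (intro AE_tendsto_0_of_summable_integral V_int V_nonneg)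
  have abs_prod: "integrable M (\<lambda>x. \<bar>X i x\<bar> * \<bar>X j x\<bar>)" if "i \<ge> 1" "j \<ge> 1" for i j
    using integrable_abs[OF prod[OF that]] by (simp add: abs_mult)
  have abs_square_sum: "(\<Sum>i\<in>I. \<bar>X i x\<bar>)\<^sup>2 = (\<Sum>i\<in>I. \<Sum>j\<in>I. \<bar>X i x\<bar> * \<bar>X j x\<bar>)" for I x
    by (simp add: power2_eq_square sum_product)
  have int_abs: "integrable M (\<lambda>x. (\<Sum>i\<in>I. \<bar>X i x\<bar>)\<^sup>2)" if "I \<subseteq> {1..}" for I
    unfolding abs_square_sum using that by (intro Bochner_Integration.integrable_sum abs_prod) auto
  have W_int: "integrable M (W n)" for n
    unfolding W_def power_divide by (intro integrable_divide_zero int_abs) auto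
  have EW: "expectation (W n) \<le> 9 * B / (Suc n)\<^sup>2" for n
  proof -
    let ?I = "{(Suc n)\<^sup>2<..(n + 2)\<^sup>2}"
    \<comment> \<open>There are \<open>2 * n + 3\<close> integers in this gap, at most
      \<open>3 * Suc n\<close>. Cauchy-Schwarz contributes one factor \<open>card ?I\<close> and the
      sum of second moments another, whence the constant \<open>9\<close>.\<close>
    have card: "real (card ?I) \<le> 3 * (Suc n)" by (simp add: power2_eq_square)
    have "expectation (\<lambda>x. (\<Sum>i\<in>?I. \<bar>X i x\<bar>)\<^sup>2) \<le> expectation (\<lambda>x. (\<Sum>i\<in>?I. (X i x)\<^sup>2) * card ?I)"
    proof (rule integral_mono)
      show "integrable M (\<lambda>x. (\<Sum>i\<in>?I. (X i x)\<^sup>2) * card ?I)"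
        by (intro integrable_mult_left Bochner_Integration.integrable_sum sq) auto
      show "(\<Sum>i\<in>?I. \<bar>X i x\<bar>)\<^sup>2 \<le> (\<Sum>i\<in>?I. (X i x)\<^sup>2) * card ?I" for x
        using sum_squared_le_sum_of_squares[of "\<lambda>i. \<bar>X i x\<bar>" ?I] by simp
    qed (intro int_abs, auto)
    also have "\<dots> = (\<Sum>i\<in>?I. expectation (\<lambda>x. (X i x)\<^sup>2)) * card ?I"
    proof -
      have "expectation (\<lambda>x. \<Sum>i\<in>?I. (X i x)\<^sup>2) = (\<Sum>i\<in>?I. expectation (\<lambda>x. (X i x)\<^sup>2))"
        by (intro Bochner_Integration.integral_sum sq) auto
      then show ?thesis by simp
    qed
    also have "\<dots> \<le> (\<Sum>i\<in>?I. B) * card ?I"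
      by (intro mult_right_mono sum_mono bound) auto
    also have "\<dots> = B * (real (card ?I))\<^sup>2" by (simp only: sum_constant) (simp add: power2_eq_square)
    also have "\<dots> \<le> B * (3 * real (Suc n))\<^sup>2"
      using B card by (intro mult_left_mono power_mono) auto
    also have "\<dots> = 9 * B * real ((Suc n)\<^sup>2)" by (simp only: power_mult_distrib of_nat_power) simp
    finally have "expectation (\<lambda>x. (\<Sum>i\<in>?I. \<bar>X i x\<bar>)\<^sup>2) \<le> 9 * B * real ((Suc n)\<^sup>2)" .
    then have "expectation (W n) \<le> 9 * B * real ((Suc n)\<^sup>2) / (real ((Suc n)\<^sup>2))\<^sup>2"
      unfolding W_def power_divide by (simp add: divide_right_mono del: of_nat_power of_nat_Suc)
    also have "\<dots> = 9 * B / (Suc n)\<^sup>2" by (simp add: power2_eq_square)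
    finally show ?thesis .
  qed
  have W_nonneg: "0 \<le> W n x" for n x by (simp add: W_def)
  have "summable (\<lambda>n. expectation (W n))"
  proof (rule summable_comparison_test'[OF summable_B])
    show "norm (expectation (W n)) \<le> 9 * B / real ((Suc n)\<^sup>2)" for n
      using EW[of n] Bochner_Integration.integral_nonneg[of M "W n"] W_nonneg
      by (simp del: of_nat_Suc of_nat_power)
  qed
  then have W_lim: "AE x in M. (\<lambda>n. W n x) \<longlonglongrightarrow> 0"
    by (intro AE_tendsto_0_of_summable_integral W_int W_nonneg)
  show ?thesis
    using V_lim W_lim
  proof eventually_elim
    case (elim x)
    define R where "R n = \<bar>\<Sum>i=1..(Suc n)\<^sup>2. X i x\<bar> / (Suc n)\<^sup>2
        + (\<Sum>i\<in>{(Suc n)\<^sup>2<..(n + 2)\<^sup>2}. \<bar>X i x\<bar>) / (Suc n)\<^sup>2" for n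
    have "R n = sqrt (V n x) + sqrt (W n x)" for n
      by (simp add: R_def V_def W_def sum_nonneg abs_divide)
    moreover have "(\<lambda>n. sqrt (V n x) + sqrt (W n x)) \<longlonglongrightarrow> 0"
      using tendsto_add[OF elim[THEN tendsto_real_sqrt]] by simp
    ultimately have "R \<longlonglongrightarrow> 0" by presburger
    then have R_lim: "(\<lambda>N. R (floor_sqrt N - 1)) \<longlonglongrightarrow> 0"
      by (rule filterlim_compose[OF _ filterlim_floor_sqrt_minus_1])
    have "norm ((\<Sum>i=1..N. X i x) / N) \<le> R (floor_sqrt N - 1)" if "N \<ge> 1" for N
      unfolding R_def real_norm_def by (rule average_le_of_squares[OF that])
    then show ?case
      by (rule Lim_null_comparison[OF eventually_sequentiallyI[of 1] R_lim])
  qed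
qed

text \<open>After centring, independence is applied only to two-element index sets, where it makes
  the variables uncorrelated. Integrability is stated for the common law \<open>D\<close>, so that
  it is checked once for all \<open>i\<close>.\<close>

lemma (in prob_space) strong_law_real:
  fixes Y :: "nat \<Rightarrow> 'a \<Rightarrow> 'b::topological_space" and f :: "'b \<Rightarrow> real"
  assumes indep: "indep_vars (\<lambda>_. borel) Y {1..}"
    and D: "\<And>i. i \<ge> 1 \<Longrightarrow> distr M borel (Y i) = D"
    and f[measurable]: "f \<in> borel_measurable borel"
    and sq: "integrable D (\<lambda>y. (f y)\<^sup>2)"
  shows "AE x in M. (\<lambda>N. (\<Sum>i=1..N. f (Y i x)) / N) \<longlonglongrightarrow> integral\<^sup>L D f"
proof -
  have Y[measurable]: "Y i \<in> borel_measurable M" if "i \<ge> 1" for i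
    using indep that unfolding indep_vars_def by auto
  have D1: "D = distr M borel (Y 1)" using D[of 1] by simp
  interpret D: prob_space D unfolding D1 by (rule prob_space_distr) simp
  have sets_D[measurable_cong]: "sets D = sets borel" by (simp add: D1)
  define \<mu> where "\<mu> = integral\<^sup>L D f"
  define g where "g y = f y - \<mu>" for y
  have g[measurable]: "g \<in> borel_measurable borel" unfolding g_def by measurable
  have f_int: "integrable D f"
    by (rule D.square_integrable_imp_integrable[OF _ sq]) measurable
  have g2_int: "integrable D (\<lambda>y. (g y)\<^sup>2)"
    unfolding g_def power2_diff using f_int sq by simp
  have g_int: "integrable D g" unfolding g_def using f_int by simp
  have g0: "integral\<^sup>L D g = 0" unfolding g_def using f_int by (simp add: \<mu>_def D.prob_space)
  have transfer: "integrable M (\<lambda>x. h (Y i x)) \<longleftrightarrow> integrable D h"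
    "expectation (\<lambda>x. h (Y i x)) = integral\<^sup>L D h"
    if "i \<ge> 1" "h \<in> borel_measurable borel" for i and h :: "'b \<Rightarrow> real"
    using that by (simp_all add: integrable_distr_eq integral_distr flip: D[OF that(1)])
  have "AE x in M. (\<lambda>N. (\<Sum>i=1..N. g (Y i x)) / N) \<longlonglongrightarrow> 0"
  proof (rule strong_law_uncorrelated)
    show "integrable M (\<lambda>x. (g (Y i x))\<^sup>2)" if "i \<ge> 1" for i
      using transfer(1)[OF that, of "\<lambda>y. (g y)\<^sup>2"] g2_int by simp
    show "expectation (\<lambda>x. (g (Y i x))\<^sup>2) \<le> integral\<^sup>L D (\<lambda>y. (g y)\<^sup>2)" if "i \<ge> 1" for i
      using transfer(2)[OF that, of "\<lambda>y. (g y)\<^sup>2"] by simp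
    show "expectation (\<lambda>x. g (Y i x) * g (Y j x)) = 0" if ij: "i \<ge> 1" "j \<ge> 1" "i \<noteq> j" for i j
    proof -
      have "indep_vars (\<lambda>_. borel) (\<lambda>i x. g (Y i x)) {i, j}"
        by (rule indep_vars_compose2[OF indep_vars_subset[OF indep]]) (use ij in auto)
      then have "expectation (\<lambda>x. \<Prod>k\<in>{i, j}. g (Y k x)) = (\<Prod>k\<in>{i, j}. expectation (\<lambda>x. g (Y k x)))"
        using ij transfer(1)[of _ g] g_int by (intro indep_vars_lebesgue_integral) auto
      then show ?thesis using ij transfer(2)[of _ g] g0 by simp
    qed
  qed (use Y in simp)
  then show ?thesis
  proof eventually_elim
    case (elim x)
    from tendsto_add[OF elim tendsto_const[of \<mu>]]
    have "(\<lambda>N. (\<Sum>i=1..N. g (Y i x)) / N + \<mu>) \<longlonglongrightarrow> \<mu>" by simp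
    moreover have "\<forall>\<^sub>F N in sequentially. (\<Sum>i=1..N. g (Y i x)) / N + \<mu> = (\<Sum>i=1..N. f (Y i x)) / N"
      by (intro eventually_sequentiallyI[of 1]) (simp add: g_def sum_subtractf field_simps)
    ultimately show ?case unfolding \<mu>_def by (rule Lim_transform_eventually)
  qed
qed

lemma (in prob_space) strong_law_complex:
  fixes Y :: "nat \<Rightarrow> 'a \<Rightarrow> 'b::topological_space" and f :: "'b \<Rightarrow> complex"
  assumes indep: "indep_vars (\<lambda>_. borel) Y {1..}"
    and D: "\<And>i. i \<ge> 1 \<Longrightarrow> distr M borel (Y i) = D"
    and f[measurable]: "f \<in> borel_measurable borel"
    and sq: "integrable D (\<lambda>y. (cmod (f y))\<^sup>2)"
  shows "AE x in M. (\<lambda>N. (\<Sum>i=1..N. f (Y i x)) / of_nat N) \<longlonglongrightarrow> integral\<^sup>L D f"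
proof -
  have D1: "D = distr M borel (Y 1)" using D[of 1] by simp
  have "Y 1 \<in> borel_measurable M" using indep unfolding indep_vars_def by auto
  then interpret D: prob_space D unfolding D1 by (rule prob_space_distr)
  have sets_D[measurable_cong]: "sets D = sets borel" by (simp add: D1)
  have "integrable D (\<lambda>y. (Re (f y))\<^sup>2)" "integrable D (\<lambda>y. (Im (f y))\<^sup>2)"
    by (rule Bochner_Integration.integrable_bound[OF sq], measurable, simp add: cmod_power2)+
  note law = this[THEN strong_law_real[OF indep D, rotated -1]]
  have "integrable D (\<lambda>y. cmod (f y))"
    by (rule D.square_integrable_imp_integrable[OF _ sq]) measurable
  then have "integrable D f" by (subst (asm) integrable_norm_iff) measurable
  then have ReIm: "integral\<^sup>L D (\<lambda>y. Re (f y)) = Re (integral\<^sup>L D f)"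
    "integral\<^sup>L D (\<lambda>y. Im (f y)) = Im (integral\<^sup>L D f)"
    by simp_all
  have "AE x in M. (\<lambda>N. (\<Sum>i=1..N. Re (f (Y i x))) / N) \<longlonglongrightarrow> Re (integral\<^sup>L D f)"
    "AE x in M. (\<lambda>N. (\<Sum>i=1..N. Im (f (Y i x))) / N) \<longlonglongrightarrow> Im (integral\<^sup>L D f)"
    unfolding ReIm[symmetric] by (rule law; measurable)+
  then show ?thesis
  proof eventually_elim
    case (elim x)
    then show ?case
      by (simp add: tendsto_complex_iff Re_divide_of_nat Im_divide_of_nat)
  qed
qed

section \<open>Moments of complex normal variables\<close>

lemma (in pair_sigma_finite) integrable_integral_mult:
  fixes f g :: "_ \<Rightarrow> real"
  assumes f: "integrable M1 f" and g: "integrable M2 g"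
  shows "integrable (M1 \<Otimes>\<^sub>M M2) (\<lambda>(x, y). f x * g y)"
    and "(\<integral>(x, y). f x * g y \<partial>(M1 \<Otimes>\<^sub>M M2)) = integral\<^sup>L M1 f * integral\<^sup>L M2 g"
proof -
  have [measurable]: "f \<in> borel_measurable M1" "g \<in> borel_measurable M2"
    using f g by auto
  show int: "integrable (M1 \<Otimes>\<^sub>M M2) (\<lambda>(x, y). f x * g y)"
    by (rule Fubini_integrable) (use f g in \<open>simp_all add: abs_mult\<close>)
  show "(\<integral>(x, y). f x * g y \<partial>(M1 \<Otimes>\<^sub>M M2)) = integral\<^sup>L M1 f * integral\<^sup>L M2 g"
    by (subst integral_fst[OF int, symmetric]) simp
qed

text \<open>These are the moments of the real and the imaginary part under
  \<open>complex_normal v\<close>, each of variance \<open>v / 2\<close>.\<close>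

definition normal_moment :: "real \<Rightarrow> nat \<Rightarrow> real" where
  "normal_moment v k = (\<integral>x. x ^ k \<partial>density lborel (\<lambda>x. ennreal (normal_density 0 (sqrt (v / 2)) x)))"

lemma normal_moment_values:
  assumes "v > 0"
  shows "normal_moment v 0 = 1" "normal_moment v (Suc 0) = 0" "normal_moment v 2 = v / 2"
    "normal_moment v 3 = 0" "normal_moment v 4 = 3 * (v / 2)\<^sup>2"
proof -
  define \<sigma> where "\<sigma> = sqrt (v / 2)"
  have \<sigma>: "\<sigma> > 0" "\<sigma>\<^sup>2 = v / 2" using assms by (simp_all add: \<sigma>_def)
  have m: "normal_moment v k = (\<integral>x. normal_density 0 \<sigma> x * (x - 0) ^ k \<partial>lborel)" for k
    unfolding normal_moment_def \<sigma>_def by (subst integral_density) simp_all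
  have even: "normal_moment v (2 * k) = fact (2 * k) / ((2 / \<sigma>\<^sup>2) ^ k * fact k)" for k
    unfolding m by (rule integral_normal_moment_even[OF \<sigma>(1)])
  have odd: "normal_moment v (2 * k + 1) = 0" for k
    unfolding m by (rule integral_normal_moment_odd[OF \<sigma>(1)])
  show "normal_moment v 0 = 1" "normal_moment v (Suc 0) = 0" "normal_moment v 3 = 0"
    using even[of 0] odd[of 0] odd[of 1] by (simp_all add: numeral_3_eq_3)
  show "normal_moment v 2 = v / 2" "normal_moment v 4 = 3 * (v / 2)\<^sup>2"
    using even[of 1] even[of 2] unfolding \<sigma>(2)
    by (simp_all add: fact_numeral power_divide numeral_eq_Suc)
qed

lemma sets_complex_normal[measurable_cong, simp]: "sets (complex_normal v) = sets borel"
  by (simp add: complex_normal_def)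

lemma measurable_Complex_pair: "(\<lambda>(x, y). Complex x y) \<in> borel_measurable (borel \<Otimes>\<^sub>M borel)"
proof -
  have "(\<lambda>(x, y). Complex x y) = (\<lambda>p. of_real (fst p) + \<i> * of_real (snd p))"
    by (auto simp: fun_eq_iff complex_eq_iff)
  then show ?thesis by simp
qed

lemma
  assumes "v > 0"
  shows prob_space_complex_normal_pos: "prob_space (complex_normal v)"
    and integrable_complex_normal_ReIm: "integrable (complex_normal v) (\<lambda>z. Re z ^ a * Im z ^ b)"
    and integral_complex_normal_ReIm:
      "(\<integral>z. Re z ^ a * Im z ^ b \<partial>complex_normal v) = normal_moment v a * normal_moment v b"
proof -
  define \<sigma> where "\<sigma> = sqrt (v / 2)"
  have \<sigma>: "\<sigma> > 0" using assms by (simp add: \<sigma>_def)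
  define N where "N = density lborel (\<lambda>x. ennreal (normal_density 0 \<sigma> x))"
  have [measurable_cong]: "sets N = sets borel" by (simp add: N_def)
  interpret N: prob_space N unfolding N_def by (rule prob_space_normal_density[OF \<sigma>])
  interpret NN: pair_prob_space N N ..
  have CN: "complex_normal v = distr (N \<Otimes>\<^sub>M N) borel (\<lambda>(x, y). Complex x y)"
    using assms by (simp add: complex_normal_def N_def \<sigma>_def)
  have mC[measurable]: "(\<lambda>(x, y). Complex x y) \<in> borel_measurable (N \<Otimes>\<^sub>M N)"
    using measurable_Complex_pair by simp
  show "prob_space (complex_normal v)"
    unfolding CN by (rule NN.prob_space_distr) measurable
  have int: "integrable N (\<lambda>x. x ^ k)" for k
    unfolding N_def using integrable_normal_moment[OF \<sigma>, of 0 k]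
    by (subst integrable_density) simp_all
  have "(\<lambda>z. Re z ^ a * Im z ^ b) \<in> borel_measurable borel" by measurable
  note distr = integrable_distr_eq[OF mC this] integral_distr[OF mC this]
  show "integrable (complex_normal v) (\<lambda>z. Re z ^ a * Im z ^ b)"
    unfolding CN distr using NN.integrable_integral_mult(1)[OF int int, of a b]
    by (simp add: case_prod_unfold)
  show "(\<integral>z. Re z ^ a * Im z ^ b \<partial>complex_normal v) = normal_moment v a * normal_moment v b"
    unfolding CN distr using NN.integrable_integral_mult(2)[OF int int, of a b]
    by (simp add: case_prod_unfold normal_moment_def N_def \<sigma>_def)
qed

lemma prob_space_complex_normal: "v \<ge> 0 \<Longrightarrow> prob_space (complex_normal v)"
  using prob_space_complex_normal_pos[of v]
  by (cases "v = 0") (auto simp: complex_normal_def prob_space_return)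

lemma integrable_complex_normal_norm:
  assumes "v \<ge> 0"
  shows "integrable (complex_normal v) (\<lambda>z. cmod z ^ n)"
proof (cases "v = 0")
  case True
  interpret prob_space "return borel (0::complex)" by (rule prob_space_return) simp
  show ?thesis
    unfolding complex_normal_def using True
    by (simp add: integrable_iff_bounded nn_integral_return)
next
  case False
  then have v: "v > 0" using assms by simp
  show ?thesis
  proof (rule Bochner_Integration.integrable_bound)
    show "integrable (complex_normal v) (\<lambda>z. 2 ^ n * (\<bar>Re z ^ n * Im z ^ 0\<bar> + \<bar>Re z ^ 0 * Im z ^ n\<bar>))"
      by (intro integrable_mult_right Bochner_Integration.integrable_add integrable_abs
          integrable_complex_normal_ReIm v)
    have "cmod z ^ n \<le> 2 ^ n * (\<bar>Re z\<bar> ^ n + \<bar>Im z\<bar> ^ n)" for z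
    proof -
      have "cmod z ^ n \<le> (2 * max \<bar>Re z\<bar> \<bar>Im z\<bar>) ^ n"
        using cmod_le[of z] by (intro power_mono) (auto simp: max_def)
      also have "\<dots> = 2 ^ n * max \<bar>Re z\<bar> \<bar>Im z\<bar> ^ n" by (simp add: power_mult_distrib)
      also have "\<dots> \<le> 2 ^ n * (\<bar>Re z\<bar> ^ n + \<bar>Im z\<bar> ^ n)"
        by (intro mult_left_mono) (auto simp: max_def)
      finally show ?thesis .
    qed
    then show "AE z in complex_normal v. norm (cmod z ^ n)
        \<le> norm (2 ^ n * (\<bar>Re z ^ n * Im z ^ 0\<bar> + \<bar>Re z ^ 0 * Im z ^ n\<bar>))"
      by (simp add: power_abs)
  qed measurable
qed

lemma borel_measurable_cnj[measurable]: "cnj \<in> borel_measurable borel"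
  by (intro borel_measurable_continuous_onI continuous_intros)

lemma integrable_complex_normal:
  assumes "v \<ge> 0"
  shows "integrable (complex_normal v) (\<lambda>z. z ^ p * cnj z ^ q)"
proof (rule Bochner_Integration.integrable_bound[OF integrable_complex_normal_norm[OF assms]])
  show "AE z in complex_normal v. norm (z ^ p * cnj z ^ q) \<le> norm (cmod z ^ (p + q))"
    by (simp add: norm_mult norm_power power_add)
qed measurable

text \<open>Exponents up to \<open>2\<close> are all that fourth-order products of the observation
  require, so the few cases are expanded into moments of the real and imaginary parts. The cases
  \<open>p < q\<close> follow from \<open>p > q\<close> by conjugation.\<close>

lemma complex_normal_moment:
  assumes v: "v \<ge> 0" and pq: "p \<le> 2" "q \<le> 2"
  shows "(\<integral>z. z ^ p * cnj z ^ q \<partial>complex_normal v) = (if p = q then fact p * of_real v ^ p else 0)"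
proof (cases "v = 0")
  case True
  \<comment> \<open>For the point mass at \<open>0\<close> the formula relies on
    \<open>0 ^ 0 = 1\<close>.\<close>
  have "(\<integral>z. z ^ p * cnj z ^ q \<partial>return borel 0) = 0 ^ p * cnj 0 ^ q"
    by (rule integral_return) measurable
  then show ?thesis using True by (cases "p = 0"; cases "q = 0") (auto simp: complex_normal_def)
next
  case False
  then have v0: "v > 0" using v by simp
  interpret prob_space "complex_normal v" by (rule prob_space_complex_normal[OF v])
  note int = integrable_complex_normal_ReIm[OF v0] and val = integral_complex_normal_ReIm[OF v0]
    and m = normal_moment_values[OF v0]
  note intp = integrable_complex_normal[OF v]
  let ?E = "\<lambda>f. integral\<^sup>L (complex_normal v) f"
  have eqI: "?E (\<lambda>z. z ^ p * cnj z ^ q) = Complex A B"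
    if "?E (\<lambda>z. Re (z ^ p * cnj z ^ q)) = A" "?E (\<lambda>z. Im (z ^ p * cnj z ^ q)) = B" for p q A B
    using that unfolding integral_Re[OF intp] integral_Im[OF intp] by (simp add: complex_eq_iff)
  have lower: "?E (\<lambda>z. z ^ p * cnj z ^ q) = (if p = q then fact p * of_real v ^ p else 0)"
    if pq: "p \<le> 2" "q \<le> p" for p q
  proof -
    consider "p = 0" "q = 0" | "p = 1" "q = 0" | "p = 1" "q = 1" | "p = 2" "q = 0"
      | "p = 2" "q = 1" | "p = 2" "q = 2"
      using pq by (auto simp: numeral_2_eq_2 le_Suc_eq)
    then show ?thesis
    proof cases
      case 1
      then show ?thesis using prob_space by simp
    next
      case 2
      have "?E (\<lambda>z. Re z) = 0" "?E (\<lambda>z. Im z) = 0"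
        using val[of 1 0] val[of 0 1] by (simp_all add: m)
      then show ?thesis using eqI[of p q] 2 by (simp add: complex_eq_iff)
    next
      case 3
      have "?E (\<lambda>z. (Re z)\<^sup>2 + (Im z)\<^sup>2) = v"
        using val[of 2 0] val[of 0 2] int[of 2 0] int[of 0 2] by (simp add: m)
      then show ?thesis
        using eqI[of p q] 3 by (simp add: complex_eq_iff power2_eq_square mult.commute)
    next
      case 4
      have "?E (\<lambda>z. (Re z)\<^sup>2 - (Im z)\<^sup>2) = 0"
        using val[of 2 0] val[of 0 2] int[of 2 0] int[of 0 2] by (simp add: m)
      moreover have "?E (\<lambda>z. 2 * (Re z * Im z)) = 0"
        using val[of 1 1] by (simp add: m)
      ultimately show ?thesis
        using eqI[of p q] 4 by (simp add: complex_eq_iff power2_eq_square mult_ac)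
    next
      case 5
      \<comment> \<open>Every monomial of \<open>z ^ 2 * cnj z\<close> is odd in the real or in the
        imaginary part.\<close>
      have "?E (\<lambda>z. Re z ^ 3 * Im z ^ 0 + Re z ^ 1 * Im z ^ 2) = 0"
        "?E (\<lambda>z. Re z ^ 0 * Im z ^ 3 + Re z ^ 2 * Im z ^ 1) = 0"
        by (simp_all only: Bochner_Integration.integral_add[OF int int] val) (simp_all add: m)
      moreover have "Re (z ^ 2 * cnj z ^ 1) = Re z ^ 3 * Im z ^ 0 + Re z ^ 1 * Im z ^ 2"
        "Im (z ^ 2 * cnj z ^ 1) = Re z ^ 0 * Im z ^ 3 + Re z ^ 2 * Im z ^ 1" for z
        by (simp_all add: power2_eq_square power3_eq_cube algebra_simps)
      ultimately have "?E (\<lambda>z. z ^ 2 * cnj z ^ 1) = Complex 0 0"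
        by (intro eqI) simp_all
      then show ?thesis using 5 by (simp add: Complex_eq)
    next
      case 6
      \<comment> \<open>Two fourth moments \<open>3 * (v / 2)\<^sup>2\<close> and two products
        \<open>(v / 2)\<^sup>2\<close> add up to \<open>2 * v\<^sup>2\<close>.\<close>
      have "?E (\<lambda>z. (Re z ^ 4 * Im z ^ 0 + Re z ^ 0 * Im z ^ 4)
          + (Re z ^ 2 * Im z ^ 2 + Re z ^ 2 * Im z ^ 2)) = 2 * v\<^sup>2"
        by (simp only: Bochner_Integration.integral_add[OF Bochner_Integration.integrable_add[OF int int]
              Bochner_Integration.integrable_add[OF int int]] Bochner_Integration.integral_add[OF int int] val)
           (simp add: m power2_eq_square)
      moreover have "Re (z ^ 2 * cnj z ^ 2) = (Re z ^ 4 * Im z ^ 0 + Re z ^ 0 * Im z ^ 4)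
          + (Re z ^ 2 * Im z ^ 2 + Re z ^ 2 * Im z ^ 2)" "Im (z ^ 2 * cnj z ^ 2) = 0" for z
        by (simp_all add: power2_eq_square power4_eq_xxxx algebra_simps)
      ultimately have "?E (\<lambda>z. z ^ 2 * cnj z ^ 2) = Complex (2 * v\<^sup>2) 0"
        by (intro eqI) simp_all
      then show ?thesis using 6 by (simp add: complex_eq_iff)
    qed
  qed
  show ?thesis
  proof (cases "q \<le> p")
    case True
    then show ?thesis using lower pq by simp
  next
    case False
    then have "cnj (?E (\<lambda>z. z ^ q * cnj z ^ p)) = 0" using lower[of q p] pq by simp
    then have "?E (\<lambda>z. cnj (z ^ q * cnj z ^ p)) = 0"
      by (simp only: Bochner_Integration.integral_cnj)
    then show ?thesis using False by (simp add: mult.commute)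
  qed
qed

section \<open>The discrete Fourier transform\<close>

text \<open>A character of the index group. With the ring product of residues,
  \<open>fourier_char (l * k)\<close> is the entry \<open>(k, l)\<close> of the Fourier matrix up to
  normalization, so shifts become multiplications by it.\<close>

definition fourier_char :: "'n::finite mod_ring \<Rightarrow> complex" where
  "fourier_char x = exp (- \<i> * of_real (2 * pi * real_of_int (to_int_mod_ring x) / real CARD('n)))"

text \<open>Ring operations reduce modulo \<open>L\<close>, while the exponent in
  \<open>dft_matrix\<close> multiplies representatives; periodicity of the exponential reconciles
  the two.\<close>

lemma exp_root_mod:
  assumes "L > 0"
  shows "exp (- \<i> * of_real (2 * pi * real_of_int (k mod int L) / real L))
    = exp (- \<i> * of_real (2 * pi * real_of_int k / real L))"
proof -
  have "real_of_int k = real_of_int (k mod int L) + real L * real_of_int (k div int L)"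
    by (metis mod_mult_div_eq of_int_add of_int_mult of_int_of_nat_eq)
  then have "2 * pi * real_of_int k / real L
      = 2 * pi * real_of_int (k mod int L) / real L + 2 * real_of_int (k div int L) * pi"
    using assms by (simp add: field_simps)
  then have eq: "- \<i> * of_real (2 * pi * real_of_int k / real L)
      = - \<i> * of_real (2 * pi * real_of_int (k mod int L) / real L)
        + 2 * of_int (- (k div int L)) * of_real pi * \<i>"
    by (simp add: algebra_simps)
  have "exp (2 * of_int (- (k div int L)) * of_real pi * \<i>) = 1"
    using exp_integer_2pi[of "of_int (- (k div int L))"] by (simp add: mult_ac)
  then show ?thesis unfolding eq exp_add by simp
qed

lemma fourier_char_add: "fourier_char (x + y) = fourier_char x * fourier_char y"
proof -
  have "to_int_mod_ring (x + y) = (to_int_mod_ring x + to_int_mod_ring y) mod int CARD('a)"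
    by transfer simp
  then show ?thesis
    by (simp only: fourier_char_def exp_root_mod[OF zero_less_card_finite] flip: exp_add)
       (simp add: field_simps)
qed

lemma fourier_char_0 [simp]: "fourier_char 0 = 1"
  by (simp add: fourier_char_def)

lemma cnj_fourier_char: "cnj (fourier_char x) = fourier_char (- x)"
proof -
  have "fourier_char (- x) * fourier_char x = 1"
    by (simp flip: fourier_char_add)
  moreover have "cnj (fourier_char x) * fourier_char x = 1"
    by (simp add: fourier_char_def exp_cnj flip: exp_add)
  moreover have "fourier_char x \<noteq> 0" by (simp add: fourier_char_def)
  ultimately show ?thesis by (metis mult_right_cancel)
qed

lemma fourier_char_neq_1:
  fixes x :: "'n::finite mod_ring"
  assumes "x \<noteq> 0"
  shows "fourier_char x \<noteq> 1"
proof
  define k where "k = to_int_mod_ring x"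
  have k: "0 < k" "k < int CARD('n)"
    using assms unfolding k_def by (transfer; auto)+
  assume "fourier_char x = 1"
  then obtain n :: int where "- (2 * pi * real_of_int k / real CARD('n)) = of_int (2 * n) * pi"
    by (auto simp: fourier_char_def exp_eq_1 simp flip: k_def)
  then have "pi * real_of_int k = pi * (of_int (- n) * of_int (int CARD('n)))"
    by (simp add: field_simps)
  then have "real_of_int k = of_int (- n) * of_int (int CARD('n))"
    by (simp only: mult_cancel_left pi_neq_zero) simp
  then have "k = (- n) * int CARD('n)" by (simp only: flip: of_int_mult of_int_eq_iff)
  then have "int CARD('n) dvd k" by simp
  then show False using k zdvd_not_zless by blast
qed

text \<open>Translating the summation variable by the generator leaves the sum unchanged and also
  multiplies it by \<open>fourier_char q\<close>, which differs from \<open>1\<close> unless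
  \<open>q = 0\<close>.\<close>

lemma sum_fourier_char:
  fixes q :: "'n::finite mod_ring"
  shows "(\<Sum>l\<in>UNIV. fourier_char (l * q)) = (if q = 0 then of_nat CARD('n) else 0)"
proof (cases "q = 0")
  case False
  define g :: "'n mod_ring" where "g = of_int_mod_ring 1"
  have gq: "g * q = q" unfolding g_def by transfer (simp add: mod_simps)
  let ?S = "\<Sum>l\<in>UNIV. fourier_char (l * q)"
  have "?S = (\<Sum>l\<in>UNIV. fourier_char ((l + g) * q))"
    by (rule sum.reindex_bij_witness[of _ "\<lambda>l. l + g" "\<lambda>l. l - g"]) auto
  also have "\<dots> = ?S * fourier_char q"
    by (simp add: distrib_right fourier_char_add sum_distrib_right gq)
  finally have "?S * (fourier_char q - 1) = 0" by (simp add: algebra_simps)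
  then show ?thesis using fourier_char_neq_1[OF False] False by simp
qed simp

lemma dft_matrix_eq:
  "dft_matrix $ k $ l = of_real (1 / sqrt (real CARD('n))) * fourier_char (l * k)"
  for k l :: "'n::finite mod_ring"
proof -
  have "to_int_mod_ring (l * k) = (to_int_mod_ring l * to_int_mod_ring k) mod int CARD('n)"
    by transfer simp
  then show ?thesis
    by (simp only: dft_matrix_def vec_lambda_beta fourier_char_def exp_root_mod[OF zero_less_card_finite])
       (simp add: mult_ac)
qed

text \<open>This is why white noise stays white: in the Fourier domain it adds \<open>sigma2\<close>
  on the diagonal only.\<close>

lemma dft_matrix_rows_orthonormal:
  fixes k k' :: "'n::finite mod_ring"
  shows "(\<Sum>l\<in>UNIV. dft_matrix $ k $ l * cnj (dft_matrix $ k' $ l)) = (if k = k' then 1 else 0)"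
proof -
  have "dft_matrix $ k $ l * cnj (dft_matrix $ k' $ l)
      = of_real (1 / real CARD('n)) * fourier_char (l * (k - k'))" for l :: "'n mod_ring"
  proof -
    have "complex_of_real (1 / sqrt (real CARD('n))) * of_real (1 / sqrt (real CARD('n)))
        = of_real (1 / real CARD('n))"
      unfolding of_real_mult[symmetric] by simp
    moreover have "fourier_char (l * (k - k')) = fourier_char (l * k) * cnj (fourier_char (l * k'))"
      by (simp add: cnj_fourier_char right_diff_distrib flip: fourier_char_add)
    ultimately show ?thesis
      unfolding dft_matrix_eq complex_cnj_mult complex_cnj_complex_of_real
      by (metis (no_types, lifting) mult.assoc mult.left_commute)
  qed
  then show ?thesis
    by (simp only: sum_distrib_left[symmetric] sum_fourier_char) simp
qed

lemma dft_nth: "dft x $ k = (\<Sum>l\<in>UNIV. dft_matrix $ k $ l * x $ l)"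
  by (simp add: dft_def matrix_vector_mult_def)

lemma dft_cyclic_shift: "dft (cyclic_shift s x) $ k = fourier_char (s * k) * dft x $ k"
proof -
  have "dft (cyclic_shift s x) $ k = (\<Sum>l\<in>UNIV. dft_matrix $ k $ (l + s) * x $ l)"
    unfolding dft_nth cyclic_shift_def
    by (rule sum.reindex_bij_witness[of _ "\<lambda>l. l + s" "\<lambda>l. l - s"]) auto
  also have "\<dots> = fourier_char (s * k) * dft x $ k"
    unfolding dft_nth dft_matrix_eq distrib_right fourier_char_add sum_distrib_left
    by (simp only: mult_ac)
  finally show ?thesis .
qed

lemma dft_add: "dft (x + y) = dft x + dft y"
  by (simp add: dft_def matrix_vector_right_distrib)

lemma dft_signal: "dft (signal r v a \<omega>) $ k = (\<Sum>i=1..r. a i \<omega> * dft (v i) $ k)"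
proof -
  have "dft (signal r v a \<omega>) $ k = (\<Sum>l\<in>UNIV. \<Sum>i=1..r. dft_matrix $ k $ l * (a i \<omega> * v i $ l))"
    by (simp add: dft_nth signal_def sum_component sum_distrib_left)
  also have "\<dots> = (\<Sum>i=1..r. \<Sum>l\<in>UNIV. dft_matrix $ k $ l * (a i \<omega> * v i $ l))"
    by (rule sum.swap)
  also have "\<dots> = (\<Sum>i=1..r. a i \<omega> * dft (v i) $ k)"
    by (simp add: dft_nth sum_distrib_left mult_ac)
  finally show ?thesis .
qed

section \<open>Moments of the observation\<close>

lemma borel_measurable_vec_lambda:
  fixes f :: "'x \<Rightarrow> 'k::finite \<Rightarrow> complex"
  assumes "\<And>k. (\<lambda>x. f x k) \<in> borel_measurable M"
  shows "(\<lambda>x. \<chi> k. f x k) \<in> borel_measurable M"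
  unfolding borel_measurable_euclidean_space[where f = "\<lambda>x. \<chi> k. f x k"]
  using assms by (auto simp: Basis_vec_def inner_axis)

lemma borel_measurable_vec_nth [measurable]: "(\<lambda>x :: complex ^ 'k::finite. x $ k) \<in> borel_measurable borel"
  by (intro borel_measurable_continuous_onI continuous_intros)

lemma complex_normal_vec_prod:
  fixes f :: "'k::finite \<Rightarrow> complex \<Rightarrow> complex"
  assumes v: "v \<ge> 0" and f: "\<And>k. integrable (complex_normal v) (f k)"
  shows "integrable (complex_normal_vec v) (\<lambda>y. \<Prod>k\<in>UNIV. f k (y $ k))"
    and "(\<integral>y. (\<Prod>k\<in>UNIV. f k (y $ k)) \<partial>complex_normal_vec v)
      = (\<Prod>k\<in>UNIV. integral\<^sup>L (complex_normal v) (f k))"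
proof -
  interpret N: prob_space "complex_normal v" by (rule prob_space_complex_normal[OF v])
  interpret PN: product_sigma_finite "\<lambda>_ :: 'k. complex_normal v" ..
  have fm[measurable]: "f k \<in> borel_measurable borel" for k
    using borel_measurable_integrable[OF f[of k]] by (simp cong: measurable_cong_sets)
  have m: "(\<lambda>z. \<chi> k. z k) \<in> measurable (PiM (UNIV :: 'k set) (\<lambda>_. complex_normal v)) borel"
    by (intro borel_measurable_vec_lambda) (simp cong: measurable_cong_sets, measurable)
  have p: "(\<lambda>y :: complex ^ 'k. \<Prod>k\<in>UNIV. f k (y $ k)) \<in> borel_measurable borel" by measurable
  note distr = integrable_distr_eq[OF m p] integral_distr[OF m p]
  show "integrable (complex_normal_vec v) (\<lambda>y. \<Prod>k\<in>UNIV. f k (y $ k))"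
    unfolding complex_normal_vec_def distr
    using PN.product_integrable_prod[OF finite_class.finite_UNIV f] by simp
  show "(\<integral>y. (\<Prod>k\<in>UNIV. f k (y $ k)) \<partial>complex_normal_vec v)
      = (\<Prod>k\<in>UNIV. integral\<^sup>L (complex_normal v) (f k))"
    unfolding complex_normal_vec_def distr
    using PN.product_integral_prod[OF finite_class.finite_UNIV f] by simp
qed

text \<open>The coefficients \<open>a i\<close> and the entries of the noise are treated as one family of variables.\<close>

locale observation_model = prob_space P
  for P :: "'p measure" +
  fixes r :: nat and lam :: "nat \<Rightarrow> real" and sigma2 :: real
    and a :: "nat \<Rightarrow> 'p \<Rightarrow> complex" and s :: "'p \<Rightarrow> 'n::finite mod_ring"
    and eta :: "'p \<Rightarrow> complex ^ 'n mod_ring"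
  assumes lam_pos: "\<And>i. i \<in> {1..r} \<Longrightarrow> lam i > 0"
    and sigma2_nonneg: "sigma2 \<ge> 0"
    and a_measurable: "\<And>i. i \<in> {1..r} \<Longrightarrow> a i \<in> borel_measurable P"
    and a_distr: "\<And>i. i \<in> {1..r} \<Longrightarrow> distr P borel (a i) = complex_normal (lam i)"
    and s_measurable [measurable]: "s \<in> measurable P (count_space UNIV)"
    and eta_measurable [measurable]: "eta \<in> borel_measurable P"
    and eta_distr: "distr P borel eta = complex_normal_vec sigma2"
    and indep: "indep_sources P r a s eta"
begin

definition index :: "(nat + 'n mod_ring) set" where
  "index = Inl ` {1..r} \<union> range Inr"

definition var :: "nat + 'n mod_ring \<Rightarrow> 'p \<Rightarrow> complex" where
  "var j \<omega> = (case j of Inl i \<Rightarrow> a i \<omega> | Inr l \<Rightarrow> eta \<omega> $ l)"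

definition weight :: "nat + 'n mod_ring \<Rightarrow> real" where
  "weight j = (case j of Inl i \<Rightarrow> lam i | Inr l \<Rightarrow> sigma2)"

lemma finite_index [simp]: "finite index"
  by (simp add: index_def)

lemma prod_index:
  fixes f :: "nat + 'n mod_ring \<Rightarrow> 'c::comm_monoid_mult"
  shows "(\<Prod>j\<in>index. f j) = (\<Prod>i\<in>{1..r}. f (Inl i)) * (\<Prod>l\<in>UNIV. f (Inr l))"
  unfolding index_def
  by (subst prod.union_disjoint) (auto simp: prod.reindex)

lemma sum_index:
  fixes f :: "nat + 'n mod_ring \<Rightarrow> 'c::comm_monoid_add"
  shows "(\<Sum>j\<in>index. f j) = (\<Sum>i\<in>{1..r}. f (Inl i)) + (\<Sum>l\<in>UNIV. f (Inr l))"
  unfolding index_def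
  by (subst sum.union_disjoint) (auto simp: sum.reindex)

lemma weight_nonneg: "j \<in> index \<Longrightarrow> weight j \<ge> 0"
  using lam_pos sigma2_nonneg by (auto simp: index_def weight_def intro: less_imp_le)

lemma var_measurable [measurable]: "j \<in> index \<Longrightarrow> var j \<in> borel_measurable P"
  using a_measurable by (auto simp: index_def var_def[abs_def])

text \<open>The indicator of \<open>s = t\<close> enters as one more independent factor, which takes
  the place of conditioning on the shift.\<close>

lemma
  fixes f :: "nat + 'n mod_ring \<Rightarrow> complex \<Rightarrow> complex"
  assumes f: "\<And>j. j \<in> index \<Longrightarrow> integrable (complex_normal (weight j)) (f j)"
  shows integrable_shift_prod_var:
      "integrable P (\<lambda>\<omega>. of_bool (s \<omega> = t) * (\<Prod>j\<in>index. f j (var j \<omega>)))"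
    and integral_shift_prod_var:
      "(\<integral>\<omega>. of_bool (s \<omega> = t) * (\<Prod>j\<in>index. f j (var j \<omega>)) \<partial>P)
        = of_real (prob {\<omega>\<in>space P. s \<omega> = t}) * (\<Prod>j\<in>index. integral\<^sup>L (complex_normal (weight j)) (f j))"
proof -
  let ?I = "Coefficient ` {1..r} \<union> {Shift, Noise}"
  \<comment> \<open>The noise vector is compressed to one complex number, the product over its
    entries, so that all sources take values in one type and \<open>indep_vars\<close> applies; the
    product is split into entries afterwards by \<open>complex_normal_vec_prod\<close>.\<close>
  define X :: "source \<Rightarrow> 'p \<Rightarrow> complex" where "X j \<omega> = (case j of Coefficient i \<Rightarrow> f (Inl i) (a i \<omega>)
    | Shift \<Rightarrow> of_bool (s \<omega> = t) | Noise \<Rightarrow> (\<Prod>l\<in>UNIV. f (Inr l) (eta \<omega> $ l)))" for j \<omega>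
  have fm: "f j \<in> borel_measurable borel" if "j \<in> index" for j
    using borel_measurable_integrable[OF f[OF that]] by (simp cong: measurable_cong_sets)
  have fm_Inl: "f (Inl i) \<in> borel_measurable borel" if "i \<in> {1..r}" for i
    using that by (intro fm) (simp add: index_def)
  have fm_Inr[measurable]: "f (Inr l) \<in> borel_measurable borel" for l
    by (intro fm) (simp add: index_def)
  have f_Inl: "integrable (complex_normal (lam i)) (f (Inl i))" if "i \<in> {1..r}" for i
    using that f[of "Inl i"] by (simp add: index_def weight_def)
  have f_Inr: "integrable (complex_normal sigma2) (f (Inr l))" for l
    using f[of "Inr l"] by (simp add: index_def weight_def)
  have pm: "(\<lambda>y :: complex ^ 'n mod_ring. \<Prod>l\<in>UNIV. f (Inr l) (y $ l)) \<in> borel_measurable borel"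
    by measurable
  have X_Coefficient: "X (Coefficient i) = f (Inl i) \<circ> a i"
    and X_Shift: "X Shift = of_bool \<circ> (\<lambda>x. x = t) \<circ> s"
    and X_Noise: "X Noise = (\<lambda>y. \<Prod>l\<in>UNIV. f (Inr l) (y $ l)) \<circ> eta" for i
    by (simp_all add: X_def fun_eq_iff)
  have X_meas: "X j \<in> borel_measurable P" if "j \<in> ?I" for j
    using that
  proof (elim UnE imageE insertE emptyE)
    fix i assume j: "j = Coefficient i" and i: "i \<in> {1..r}"
    show ?thesis unfolding j X_Coefficient
      by (rule measurable_comp[OF a_measurable[OF i] fm_Inl[OF i]])
  next
    assume "j = Shift"
    then show ?thesis by (simp add: X_def[abs_def])
  next
    assume j: "j = Noise"
    show ?thesis unfolding j X_Noise by (rule measurable_comp[OF eta_measurable pm])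
  qed
  \<comment> \<open>A measurable function of a source generates no events beyond those of the
    source, so independence is inherited.\<close>
  have vimage: "(g \<circ> h) -` A \<inter> space P \<in> {h -` A \<inter> space P |A. A \<in> sets N}"
    if "g \<in> borel_measurable N" "space N = UNIV" "A \<in> sets borel" for g :: "'c \<Rightarrow> complex" and h N A
    using measurable_sets[OF that(1,3)] that(2) by (auto simp: vimage_comp[symmetric])
  have "indep_vars (\<lambda>_. borel) X ?I"
    unfolding indep_vars_def2
  proof (intro conjI ballI X_meas)
    have "indep_sets (source_events P a s eta) ?I"
      using indep unfolding indep_sources_def .
    then show "indep_sets (\<lambda>j. {X j -` A \<inter> space P |A. A \<in> sets borel}) ?I"
    proof (rule indep_sets_mono_sets)
      fix j assume "j \<in> ?I"
      then show "{X j -` A \<inter> space P |A. A \<in> sets borel} \<subseteq> source_events P a s eta j"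
      proof (elim UnE imageE insertE emptyE)
        fix i assume "j = Coefficient i" "i \<in> {1..r}"
        then show ?thesis
          using vimage[OF fm_Inl, of i _ "a i"] by (auto simp: X_Coefficient source_events_def)
      next
        assume "j = Shift"
        then show ?thesis
          using vimage[of "of_bool \<circ> (\<lambda>x. x = t)" "count_space UNIV" _ s]
          by (auto simp: X_Shift source_events_def)
      next
        assume "j = Noise"
        then show ?thesis
          using vimage[OF pm, of _ eta] by (auto simp: X_Noise source_events_def)
      qed
    qed
  qed
  note indep_X = this
  have X_val: "integrable P (X (Coefficient i)) \<and>
      integral\<^sup>L P (X (Coefficient i)) = integral\<^sup>L (complex_normal (weight (Inl i))) (f (Inl i))"
    if "i \<in> {1..r}" for i
    using f_Inl[OF that] unfolding X_Coefficient comp_def weight_def a_distr[OF that, symmetric]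
    by (simp add: integrable_distr_eq[OF a_measurable[OF that] fm_Inl[OF that]]
        integral_distr[OF a_measurable[OF that] fm_Inl[OF that]] flip: a_distr[OF that])
  have X_val_Noise: "integrable P (X Noise)"
      "integral\<^sup>L P (X Noise) = (\<Prod>l\<in>UNIV. integral\<^sup>L (complex_normal (weight (Inr l))) (f (Inr l)))"
    using complex_normal_vec_prod[where f = "\<lambda>l. f (Inr l)", OF sigma2_nonneg f_Inr]
    unfolding eta_distr[symmetric] integrable_distr_eq[OF eta_measurable pm]
      integral_distr[OF eta_measurable pm]
    by (simp_all add: X_Noise comp_def weight_def)
  have X_val_Shift: "integrable P (X Shift)" "integral\<^sup>L P (X Shift) = of_real (prob {\<omega>\<in>space P. s \<omega> = t})"
  proof -
    define A where "A = {\<omega>\<in>space P. s \<omega> = t}"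
    have A: "A \<in> events" unfolding A_def by measurable
    have A_int: "integrable P (\<lambda>\<omega>. indicat_real A \<omega>)"
      by (intro integrable_real_indicator A) (simp add: emeasure_eq_measure)
    have A_space: "A \<inter> space P = A" by (auto simp: A_def)
    have eq: "X Shift \<omega> = of_real (indicator A \<omega>)" if "\<omega> \<in> space P" for \<omega>
      using that by (simp add: X_def A_def)
    show "integrable P (X Shift)"
      using integrable_of_real[OF A_int] by (simp add: eq cong: Bochner_Integration.integrable_cong)
    have "integral\<^sup>L P (X Shift) = (\<integral>\<omega>. complex_of_real (indicator A \<omega>) \<partial>P)"
      by (intro Bochner_Integration.integral_cong eq) auto
    also have "\<dots> = of_real (prob A)"
      by (simp only: Bochner_Integration.integral_of_real[OF A_int])
         (simp add: Bochner_Integration.integral_indicator A_space)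
    finally show "integral\<^sup>L P (X Shift) = of_real (prob {\<omega>\<in>space P. s \<omega> = t})"
      by (simp add: A_def)
  qed
  have prod_I: "(\<Prod>j\<in>?I. g j) = g Shift * ((\<Prod>i\<in>{1..r}. g (Coefficient i)) * g Noise)"
    for g :: "source \<Rightarrow> complex"
    by (subst prod.union_disjoint) (auto simp: prod.reindex inj_on_def mult_ac)
  have X_prod: "(\<Prod>j\<in>?I. X j \<omega>) = of_bool (s \<omega> = t) * (\<Prod>j\<in>index. f j (var j \<omega>))" for \<omega>
    unfolding prod_I prod_index by (simp add: X_def var_def)
  have fin: "finite ?I" by simp
  have X_int: "integrable P (X j)" if "j \<in> ?I" for j
    using that X_val X_val_Shift X_val_Noise by auto
  show "integrable P (\<lambda>\<omega>. of_bool (s \<omega> = t) * (\<Prod>j\<in>index. f j (var j \<omega>)))"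
    using indep_vars_integrable[OF fin indep_X X_int] unfolding X_prod .
  have "(\<integral>\<omega>. of_bool (s \<omega> = t) * (\<Prod>j\<in>index. f j (var j \<omega>)) \<partial>P) = (\<Prod>j\<in>?I. integral\<^sup>L P (X j))"
    using indep_vars_lebesgue_integral[OF fin indep_X X_int] unfolding X_prod .
  also have "\<dots> = of_real (prob {\<omega>\<in>space P. s \<omega> = t})
      * (\<Prod>j\<in>index. integral\<^sup>L (complex_normal (weight j)) (f j))"
    unfolding prod_I prod_index by (simp add: X_val X_val_Shift X_val_Noise)
  finally show "(\<integral>\<omega>. of_bool (s \<omega> = t) * (\<Prod>j\<in>index. f j (var j \<omega>)) \<partial>P)
        = of_real (prob {\<omega>\<in>space P. s \<omega> = t}) * (\<Prod>j\<in>index. integral\<^sup>L (complex_normal (weight j)) (f j))" .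
qed

abbreviation shift_prob :: "'n mod_ring \<Rightarrow> real" where
  "shift_prob t \<equiv> prob {\<omega>\<in>space P. s \<omega> = t}"

lemma sum_shift_prob: "(\<Sum>t\<in>UNIV. shift_prob t) = 1"
proof -
  have "(\<Sum>t\<in>UNIV. shift_prob t) = prob (\<Union>t\<in>UNIV. {\<omega>\<in>space P. s \<omega> = t})"
    by (rule finite_measure_finite_Union[symmetric]) (auto simp: disjoint_family_on_def)
  also have "(\<Union>t\<in>UNIV. {\<omega>\<in>space P. s \<omega> = t}) = space P" by auto
  finally show ?thesis by (simp add: prob_space)
qed

text \<open>The law of total expectation in the case where the conditional value \<open>c\<close> is
  the same for every shift, which makes the distribution of \<open>s\<close> irrelevant.\<close>

lemma has_bochner_integral_over_shifts:
  fixes g :: "'n mod_ring \<Rightarrow> 'p \<Rightarrow> complex"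
  assumes "\<And>t. has_bochner_integral P (\<lambda>\<omega>. of_bool (s \<omega> = t) * g t \<omega>) (of_real (shift_prob t) * c)"
  shows "has_bochner_integral P (\<lambda>\<omega>. g (s \<omega>) \<omega>) c"
proof -
  have "has_bochner_integral P (\<lambda>\<omega>. \<Sum>t\<in>UNIV. of_bool (s \<omega> = t) * g t \<omega>)
      (\<Sum>t\<in>UNIV. of_real (shift_prob t) * c)"
    by (intro has_bochner_integral_sum assms)
  moreover have "(\<Sum>t\<in>UNIV. of_bool (s \<omega> = t) * g t \<omega>) = g (s \<omega>) \<omega>" for \<omega>
    by (simp add: of_bool_def if_distrib[of "\<lambda>x. x * _"] cong: if_cong)
  moreover have "(\<Sum>t\<in>UNIV. of_real (shift_prob t) * c) = c"
    by (simp only: sum_shift_prob sum_distrib_right[symmetric] of_real_sum[symmetric]) simp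
  ultimately show ?thesis by simp
qed

section \<open>Joint moments of the coefficients and the noise up to order four\<close>

lemma monomial_moment:
  fixes p q :: "nat + 'n mod_ring \<Rightarrow> nat"
  assumes "\<And>j. p j \<le> 2" "\<And>j. q j \<le> 2"
  shows "has_bochner_integral P
    (\<lambda>\<omega>. of_bool (s \<omega> = t) * (\<Prod>j\<in>index. var j \<omega> ^ p j * cnj (var j \<omega>) ^ q j))
    (of_real (shift_prob t)
      * (\<Prod>j\<in>index. if p j = q j then fact (p j) * of_real (weight j) ^ p j else 0))"
proof -
  have int: "integrable (complex_normal (weight j)) (\<lambda>z. z ^ p j * cnj z ^ q j)" if "j \<in> index" for j
    by (rule integrable_complex_normal[OF weight_nonneg[OF that]])
  have "(\<Prod>j\<in>index. \<integral>z. z ^ p j * cnj z ^ q j \<partial>complex_normal (weight j))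
      = (\<Prod>j\<in>index. if p j = q j then fact (p j) * of_real (weight j) ^ p j else 0)"
    using assms by (intro prod.cong refl complex_normal_moment weight_nonneg)
  then show ?thesis
    using integrable_shift_prod_var[OF int, of t] integral_shift_prod_var[OF int, of t]
    by (simp add: has_bochner_integral_iff)
qed

lemma prod_power_of_bool:
  fixes x :: "nat + 'n mod_ring \<Rightarrow> 'c::comm_monoid_mult"
  assumes "i \<in> index"
  shows "(\<Prod>j\<in>index. x j ^ of_bool (j = i)) = x i"
proof -
  have "(\<Prod>j\<in>index. x j ^ of_bool (j = i)) = (\<Prod>j\<in>index. if j = i then x j else 1)"
    by (intro prod.cong) auto
  then show ?thesis using assms by simp
qed

lemma second_moment:
  assumes "i \<in> index" "k \<in> index"
  shows "has_bochner_integral P (\<lambda>\<omega>. of_bool (s \<omega> = t) * (var i \<omega> * cnj (var k \<omega>)))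
    (of_real (shift_prob t) * (of_real (weight i) * of_bool (k = i)))"
proof -
  let ?p = "\<lambda>j. of_bool (j = i) :: nat" and ?q = "\<lambda>j. of_bool (j = k) :: nat"
  have "(\<Prod>j\<in>index. if ?p j = ?q j then fact (?p j) * of_real (weight j) ^ ?p j else 0)
      = (of_real (weight i) * of_bool (k = i) :: complex)"
  proof (cases "k = i")
    case True
    have "(\<Prod>j\<in>index. if ?p j = ?q j then fact (?p j) * of_real (weight j) ^ ?p j else 0)
        = (\<Prod>j\<in>index. of_real (weight j) ^ ?p j :: complex)"
      using True by (intro prod.cong) auto
    then show ?thesis using True by (simp only: prod_power_of_bool[OF assms(1)]) simp
  next
    case False
    then show ?thesis using assms by (auto intro!: prod_zero bexI[of _ i])
  qed
  then show ?thesis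
    using monomial_moment[of ?p ?q t]
    by (simp add: prod.distrib prod_power_of_bool assms)
qed

lemma fourth_moment:
  assumes "i \<in> index" "k \<in> index" "i' \<in> index" "k' \<in> index"
  shows "has_bochner_integral P
    (\<lambda>\<omega>. of_bool (s \<omega> = t) * (var i \<omega> * cnj (var k \<omega>) * var i' \<omega> * cnj (var k' \<omega>)))
    (of_real (shift_prob t) * (of_real (weight i) * of_real (weight i')
      * (of_bool (k = i) * of_bool (k' = i') + of_bool (k = i') * of_bool (k' = i))))"
proof -
  \<comment> \<open>Adding indicators records multiplicities, so coinciding indices need no separate
    monomial.\<close>
  let ?p = "\<lambda>j. of_bool (j = i) + of_bool (j = i') :: nat"
    and ?q = "\<lambda>j. of_bool (j = k) + of_bool (j = k') :: nat"
  have "(\<Prod>j\<in>index. if ?p j = ?q j then fact (?p j) * of_real (weight j) ^ ?p j else 0)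
      = (of_real (weight i) * of_real (weight i')
      * (of_bool (k = i) * of_bool (k' = i') + of_bool (k = i') * of_bool (k' = i)) :: complex)"
  proof (cases "(k = i \<and> k' = i') \<or> (k = i' \<and> k' = i)")
    case True
    \<comment> \<open>If \<open>i = i'\<close>, the exponent is \<open>2\<close> and its factorial
      is the factor \<open>2\<close>; on the other side both pairings hold at once.\<close>
    have "(\<Prod>j\<in>index. if ?p j = ?q j then fact (?p j) * of_real (weight j) ^ ?p j else 0)
        = (\<Prod>j\<in>index. (if j = i then if i = i' then 2 else 1 else 1)
            * (of_real (weight j) ^ of_bool (j = i) * of_real (weight j) ^ of_bool (j = i')) :: complex)"
      using True by (intro prod.cong) auto
    also have "\<dots> = (if i = i' then 2 else 1) * (of_real (weight i) * of_real (weight i'))"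
      using assms by (simp only: prod.distrib prod_power_of_bool prod.delta finite_index if_True)
    finally show ?thesis using True by auto
  next
    case False
    \<comment> \<open>If no pairing matches, the two multisets of indices differ, and one unbalanced
      index kills the product.\<close>
    then have "?p i \<noteq> ?q i \<or> ?p i' \<noteq> ?q i'" by auto
    then obtain j where j: "j \<in> index" "?p j \<noteq> ?q j" using assms by blast
    have "(\<Prod>j\<in>index. if ?p j = ?q j then fact (?p j) * of_real (weight j) ^ ?p j else 0) = (0 :: complex)"
      by (rule prod_zero[OF finite_index]) (rule bexI[of _ j], rule if_not_P[OF j(2)], rule j(1))
    moreover have "of_bool (k = i) * of_bool (k' = i') + of_bool (k = i') * of_bool (k' = i) = (0 :: complex)"
      using False by auto
    ultimately show ?thesis by (simp only: mult_zero_right)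
  qed
  then show ?thesis
    using monomial_moment[of ?p ?q t]
    by (simp add: prod.distrib power_add prod_power_of_bool assms mult_ac)
qed

section \<open>Isserlis' formula for linear forms\<close>

definition linear_form :: "(nat + 'n mod_ring \<Rightarrow> complex) \<Rightarrow> 'p \<Rightarrow> complex" where
  "linear_form \<alpha> \<omega> = (\<Sum>j\<in>index. \<alpha> j * var j \<omega>)"

text \<open>The expectation of one form times the conjugate of the other, since the variables are
  uncorrelated with variances \<open>weight j\<close>.\<close>

definition form_covariance ::
    "(nat + 'n mod_ring \<Rightarrow> complex) \<Rightarrow> (nat + 'n mod_ring \<Rightarrow> complex) \<Rightarrow> complex" where
  "form_covariance \<alpha> \<beta> = (\<Sum>j\<in>index. of_real (weight j) * (\<alpha> j * cnj (\<beta> j)))"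

lemma sum_of_bool_eq:
  fixes f :: "nat + 'n mod_ring \<Rightarrow> complex"
  assumes "i \<in> index"
  shows "(\<Sum>j\<in>index. f j * of_bool (j = i)) = f i"
  using assms by (simp add: of_bool_def if_distrib[of "\<lambda>x. _ * x"] cong: if_cong)

lemma linear_form_second_moment:
  "has_bochner_integral P (\<lambda>\<omega>. of_bool (s \<omega> = t) * (linear_form \<alpha> \<omega> * cnj (linear_form \<beta> \<omega>)))
    (of_real (shift_prob t) * form_covariance \<alpha> \<beta>)"
proof -
  have "has_bochner_integral P
      (\<lambda>\<omega>. \<Sum>i\<in>index. \<Sum>k\<in>index. (\<alpha> i * cnj (\<beta> k)) * (of_bool (s \<omega> = t) * (var i \<omega> * cnj (var k \<omega>))))
      (\<Sum>i\<in>index. \<Sum>k\<in>index. (\<alpha> i * cnj (\<beta> k))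
        * (of_real (shift_prob t) * (of_real (weight i) * of_bool (k = i))))"
    by (intro has_bochner_integral_sum has_bochner_integral_mult_right second_moment) auto
  moreover have "(\<Sum>i\<in>index. \<Sum>k\<in>index. (\<alpha> i * cnj (\<beta> k)) * (of_bool (s \<omega> = t) * (var i \<omega> * cnj (var k \<omega>))))
      = of_bool (s \<omega> = t) * (linear_form \<alpha> \<omega> * cnj (linear_form \<beta> \<omega>))" for \<omega>
    unfolding linear_form_def cnj_sum sum_product by (simp add: sum_distrib_left mult_ac)
  moreover have "(\<Sum>i\<in>index. \<Sum>k\<in>index. (\<alpha> i * cnj (\<beta> k))
        * (of_real (shift_prob t) * (of_real (weight i) * of_bool (k = i))))
      = of_real (shift_prob t) * form_covariance \<alpha> \<beta>"
  proof -
    have "(\<Sum>k\<in>index. (\<alpha> i * cnj (\<beta> k)) * (of_real (shift_prob t) * (of_real (weight i) * of_bool (k = i))))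
        = of_real (shift_prob t) * (of_real (weight i) * (\<alpha> i * cnj (\<beta> i)))" if "i \<in> index" for i
    proof -
      have "(\<Sum>k\<in>index. (\<alpha> i * cnj (\<beta> k)) * (of_real (shift_prob t) * (of_real (weight i) * of_bool (k = i))))
          = (\<Sum>k\<in>index. (of_real (shift_prob t) * (of_real (weight i) * (\<alpha> i * cnj (\<beta> k)))) * of_bool (k = i))"
        by (simp add: mult_ac)
      then show ?thesis by (simp only: sum_of_bool_eq[OF that])
    qed
    then show ?thesis by (simp add: form_covariance_def sum_distrib_left)
  qed
  ultimately show ?thesis by simp
qed

text \<open>By multilinearity it is enough to know the moments of the variables. For circular
  variables only pairings of an unconjugated with a conjugated factor survive, which leaves two of
  the three pairings.\<close>

lemma linear_form_fourth_moment:
  "has_bochner_integral P (\<lambda>\<omega>. of_bool (s \<omega> = t) * (linear_form \<alpha> \<omega> * cnj (linear_form \<beta> \<omega>)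
      * linear_form \<gamma> \<omega> * cnj (linear_form \<delta> \<omega>)))
    (of_real (shift_prob t) * (form_covariance \<alpha> \<beta> * form_covariance \<gamma> \<delta>
      + form_covariance \<alpha> \<delta> * form_covariance \<gamma> \<beta>))"
proof -
  let ?m = "\<lambda>i k i' k'. of_real (weight i) * of_real (weight i')
      * (of_bool (k = i) * of_bool (k' = i') + of_bool (k = i') * of_bool (k' = i)) :: complex"
  have "has_bochner_integral P
      (\<lambda>\<omega>. \<Sum>i\<in>index. \<Sum>i'\<in>index. \<Sum>k\<in>index. \<Sum>k'\<in>index. (\<alpha> i * cnj (\<beta> k) * \<gamma> i' * cnj (\<delta> k'))
        * (of_bool (s \<omega> = t) * (var i \<omega> * cnj (var k \<omega>) * var i' \<omega> * cnj (var k' \<omega>))))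
      (\<Sum>i\<in>index. \<Sum>i'\<in>index. \<Sum>k\<in>index. \<Sum>k'\<in>index. (\<alpha> i * cnj (\<beta> k) * \<gamma> i' * cnj (\<delta> k'))
        * (of_real (shift_prob t) * ?m i k i' k'))"
    by (intro has_bochner_integral_sum has_bochner_integral_mult_right fourth_moment) auto
  moreover have "(\<Sum>i\<in>index. \<Sum>i'\<in>index. \<Sum>k\<in>index. \<Sum>k'\<in>index. (\<alpha> i * cnj (\<beta> k) * \<gamma> i' * cnj (\<delta> k'))
        * (of_bool (s \<omega> = t) * (var i \<omega> * cnj (var k \<omega>) * var i' \<omega> * cnj (var k' \<omega>))))
      = of_bool (s \<omega> = t) * (linear_form \<alpha> \<omega> * cnj (linear_form \<beta> \<omega>)
          * linear_form \<gamma> \<omega> * cnj (linear_form \<delta> \<omega>))" for \<omega>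
  proof -
    have "of_bool (s \<omega> = t) * (linear_form \<alpha> \<omega> * cnj (linear_form \<beta> \<omega>)
          * linear_form \<gamma> \<omega> * cnj (linear_form \<delta> \<omega>))
        = of_bool (s \<omega> = t) * ((linear_form \<alpha> \<omega> * linear_form \<gamma> \<omega>)
          * (cnj (linear_form \<beta> \<omega>) * cnj (linear_form \<delta> \<omega>)))"
      by (simp only: mult_ac)
    also have "\<dots> = of_bool (s \<omega> = t) * (\<Sum>i\<in>index. \<Sum>i'\<in>index. \<Sum>k\<in>index. \<Sum>k'\<in>index.
        (\<alpha> i * var i \<omega> * (\<gamma> i' * var i' \<omega>)) * (cnj (\<beta> k * var k \<omega>) * cnj (\<delta> k' * var k' \<omega>)))"
      unfolding linear_form_def cnj_sum sum_product[of "\<lambda>j. \<alpha> j * var j \<omega>"]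
        sum_product[of "\<lambda>j. cnj (\<beta> j * var j \<omega>)"]
      unfolding sum_distrib_right unfolding sum_distrib_left ..
    also have "\<dots> = (\<Sum>i\<in>index. \<Sum>i'\<in>index. \<Sum>k\<in>index. \<Sum>k'\<in>index. (\<alpha> i * cnj (\<beta> k) * \<gamma> i' * cnj (\<delta> k'))
        * (of_bool (s \<omega> = t) * (var i \<omega> * cnj (var k \<omega>) * var i' \<omega> * cnj (var k' \<omega>))))"
      by (simp only: sum_distrib_left complex_cnj_mult mult_ac)
    finally show ?thesis ..
  qed
  moreover have "(\<Sum>i\<in>index. \<Sum>i'\<in>index. \<Sum>k\<in>index. \<Sum>k'\<in>index. (\<alpha> i * cnj (\<beta> k) * \<gamma> i' * cnj (\<delta> k'))
        * (of_real (shift_prob t) * ?m i k i' k'))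
      = of_real (shift_prob t) * (form_covariance \<alpha> \<beta> * form_covariance \<gamma> \<delta>
          + form_covariance \<alpha> \<delta> * form_covariance \<gamma> \<beta>)"
  proof -
    have inner: "(\<Sum>k\<in>index. \<Sum>k'\<in>index. (\<alpha> i * cnj (\<beta> k) * \<gamma> i' * cnj (\<delta> k')) * (of_real (shift_prob t) * ?m i k i' k'))
        = of_real (shift_prob t) * ((of_real (weight i) * (\<alpha> i * cnj (\<beta> i))) * (of_real (weight i') * (\<gamma> i' * cnj (\<delta> i'))))
        + of_real (shift_prob t) * ((of_real (weight i) * (\<alpha> i * cnj (\<delta> i))) * (of_real (weight i') * (\<gamma> i' * cnj (\<beta> i'))))"
      if ii: "i \<in> index" "i' \<in> index" for i i'
    proof -
      let ?c = "of_real (shift_prob t) * (of_real (weight i) * of_real (weight i') * (\<alpha> i * \<gamma> i'))"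
      have "(\<Sum>k\<in>index. \<Sum>k'\<in>index. (\<alpha> i * cnj (\<beta> k) * \<gamma> i' * cnj (\<delta> k')) * (of_real (shift_prob t) * ?m i k i' k'))
          = (\<Sum>k\<in>index. \<Sum>k'\<in>index. ?c * ((cnj (\<beta> k) * of_bool (k = i)) * (cnj (\<delta> k') * of_bool (k' = i')))
              + ?c * ((cnj (\<beta> k) * of_bool (k = i')) * (cnj (\<delta> k') * of_bool (k' = i))))"
        by (intro sum.cong refl) (simp only: distrib_left mult_ac)
      also have "\<dots> = ?c * ((\<Sum>k\<in>index. cnj (\<beta> k) * of_bool (k = i)) * (\<Sum>k'\<in>index. cnj (\<delta> k') * of_bool (k' = i')))
          + ?c * ((\<Sum>k\<in>index. cnj (\<beta> k) * of_bool (k = i')) * (\<Sum>k'\<in>index. cnj (\<delta> k') * of_bool (k' = i)))"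
        unfolding sum_product unfolding sum_distrib_left sum.distrib ..
      also have "\<dots> = ?c * (cnj (\<beta> i) * cnj (\<delta> i')) + ?c * (cnj (\<beta> i') * cnj (\<delta> i))"
        by (simp only: sum_of_bool_eq ii)
      finally show ?thesis by (simp only: mult_ac)
    qed
    have "(\<Sum>i\<in>index. \<Sum>i'\<in>index. \<Sum>k\<in>index. \<Sum>k'\<in>index. (\<alpha> i * cnj (\<beta> k) * \<gamma> i' * cnj (\<delta> k'))
        * (of_real (shift_prob t) * ?m i k i' k'))
      = (\<Sum>i\<in>index. \<Sum>i'\<in>index.
          of_real (shift_prob t) * ((of_real (weight i) * (\<alpha> i * cnj (\<beta> i))) * (of_real (weight i') * (\<gamma> i' * cnj (\<delta> i'))))
        + of_real (shift_prob t) * ((of_real (weight i) * (\<alpha> i * cnj (\<delta> i))) * (of_real (weight i') * (\<gamma> i' * cnj (\<beta> i')))))"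
      by (intro sum.cong refl inner)
    also have "\<dots> = of_real (shift_prob t) * (form_covariance \<alpha> \<beta> * form_covariance \<gamma> \<delta>)
          + of_real (shift_prob t) * (form_covariance \<alpha> \<delta> * form_covariance \<gamma> \<beta>)"
      unfolding form_covariance_def sum_product unfolding sum_distrib_left sum.distrib ..
    finally show ?thesis by (simp only: distrib_left)
  qed
  ultimately show ?thesis by simp
qed

lemma integrable_norm_var_power: "integrable P (\<lambda>\<omega>. cmod (var i \<omega>) ^ n)" if i: "i \<in> index"
proof -
  \<comment> \<open>All other factors are \<open>1\<close>, which reduces the claim to the product
    formula; summing over \<open>t\<close> removes the indicator of the shift.\<close>
  define f where "f j z = (if j = i then of_real (cmod z ^ n) else 1 :: complex)" for j z
  have f_int: "integrable (complex_normal (weight j)) (f j)" if "j \<in> index" for j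
  proof -
    interpret N: prob_space "complex_normal (weight j)"
      by (rule prob_space_complex_normal[OF weight_nonneg[OF that]])
    have "integrable (complex_normal (weight j)) (\<lambda>z. of_real (cmod z ^ n) :: complex)"
      by (rule integrable_of_real[OF integrable_complex_normal_norm[OF weight_nonneg[OF that]]])
    then show ?thesis by (cases "j = i") (simp_all add: f_def[abs_def])
  qed
  have "(\<Prod>j\<in>index. f j (var j \<omega>)) = of_real (cmod (var i \<omega>) ^ n)" for \<omega>
    using i unfolding f_def by (subst prod.delta) auto
  then have "integrable P (\<lambda>\<omega>. of_bool (s \<omega> = t) * of_real (cmod (var i \<omega>) ^ n) :: complex)" for t
    using integrable_shift_prod_var[OF f_int, of t] by simp
  then have "integrable P (\<lambda>\<omega>. \<Sum>t\<in>UNIV. of_bool (s \<omega> = t) * of_real (cmod (var i \<omega>) ^ n) :: complex)"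
    by (intro Bochner_Integration.integrable_sum)
  moreover have "(\<Sum>t\<in>UNIV. of_bool (s \<omega> = t) * of_real (cmod (var i \<omega>) ^ n))
      = (of_real (cmod (var i \<omega>) ^ n) :: complex)" for \<omega>
    by (simp add: of_bool_def if_distrib[of "\<lambda>x. x * _"] cong: if_cong)
  ultimately have "integrable P (\<lambda>\<omega>. of_real (cmod (var i \<omega>) ^ n) :: complex)" by simp
  from integrable_Re[OF this] show ?thesis by simp
qed

text \<open>The sum is at most the number of terms times the largest one. It serves as an integrable
  dominating function of arbitrary degree.\<close>

lemma integrable_sum_norm_var_power: "integrable P (\<lambda>\<omega>. (\<Sum>j\<in>index. cmod (var j \<omega>)) ^ n)"
proof (rule Bochner_Integration.integrable_bound)
  show "integrable P (\<lambda>\<omega>. real (card index) ^ n * (\<Sum>j\<in>index. cmod (var j \<omega>) ^ n))"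
    by (intro integrable_mult_right Bochner_Integration.integrable_sum integrable_norm_var_power)
  have "(\<Sum>j\<in>index. cmod (var j \<omega>)) ^ n \<le> real (card index) ^ n * (\<Sum>j\<in>index. cmod (var j \<omega>) ^ n)" for \<omega>
  proof -
    \<comment> \<open>The entries of the noise keep the index set nonempty even for
      \<open>r = 0\<close>.\<close>
    have "(\<lambda>j. cmod (var j \<omega>)) ` index \<noteq> {}" by (auto simp: index_def)
    then have "Max ((\<lambda>j. cmod (var j \<omega>)) ` index) \<in> (\<lambda>j. cmod (var j \<omega>)) ` index"
      by (intro Max_in) auto
    then obtain i where "i \<in> index" "Max ((\<lambda>j. cmod (var j \<omega>)) ` index) = cmod (var i \<omega>)"
      by (elim imageE)
    then have i: "i \<in> index" "\<And>j. j \<in> index \<Longrightarrow> cmod (var j \<omega>) \<le> cmod (var i \<omega>)"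
      by (auto simp flip: \<open>Max _ = _\<close>)
    have "(\<Sum>j\<in>index. cmod (var j \<omega>)) \<le> real (card index) * cmod (var i \<omega>)"
      using i(2) by (rule sum_bounded_above)
    then have "(\<Sum>j\<in>index. cmod (var j \<omega>)) ^ n \<le> (real (card index) * cmod (var i \<omega>)) ^ n"
      by (intro power_mono sum_nonneg) auto
    also have "\<dots> = real (card index) ^ n * cmod (var i \<omega>) ^ n" by (rule power_mult_distrib)
    also have "cmod (var i \<omega>) ^ n \<le> (\<Sum>j\<in>index. cmod (var j \<omega>) ^ n)"
      by (rule member_le_sum[OF i(1)]) auto
    finally show ?thesis by (simp add: mult_left_mono)
  qed
  then show "AE \<omega> in P. norm ((\<Sum>j\<in>index. cmod (var j \<omega>)) ^ n)
      \<le> norm (real (card index) ^ n * (\<Sum>j\<in>index. cmod (var j \<omega>) ^ n))"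
    by (intro AE_I2) (simp add: sum_nonneg)
qed measurable

section \<open>Fourier coefficients of the observation as linear forms\<close>

definition signal_coeff :: "(nat \<Rightarrow> complex ^ 'n mod_ring) \<Rightarrow> 'n mod_ring \<Rightarrow> nat + 'n mod_ring \<Rightarrow> complex" where
  "signal_coeff v k j = (case j of Inl i \<Rightarrow> dft (v i) $ k | Inr l \<Rightarrow> 0)"

text \<open>With the shift frozen at \<open>t\<close> the coefficients are deterministic, so the
  moment formulas for linear forms apply.\<close>

definition observation_coeff ::
    "(nat \<Rightarrow> complex ^ 'n mod_ring) \<Rightarrow> 'n mod_ring \<Rightarrow> 'n mod_ring \<Rightarrow> nat + 'n mod_ring \<Rightarrow> complex" where
  "observation_coeff v t k j = (case j of Inl i \<Rightarrow> fourier_char (t * k) * dft (v i) $ k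
     | Inr l \<Rightarrow> dft_matrix $ k $ l)"

text \<open>The matrix \<open>S\<close> of the overview.\<close>

definition covariance :: "(nat \<Rightarrow> complex ^ 'n mod_ring) \<Rightarrow> 'n mod_ring \<Rightarrow> 'n mod_ring \<Rightarrow> complex" where
  "covariance v k l = fourier_covariance P (signal r v a) $ k $ l + (if k = l then of_real sigma2 else 0)"

lemma dft_signal_linear_form: "dft (signal r v a \<omega>) $ k = linear_form (signal_coeff v k) \<omega>"
  by (simp add: dft_signal linear_form_def sum_index signal_coeff_def var_def mult.commute)

lemma dft_observation_linear_form:
  "dft (observation (signal r v a) s eta \<omega>) $ k = linear_form (observation_coeff v (s \<omega>) k) \<omega>"
  by (simp add: observation_def dft_add dft_cyclic_shift dft_signal dft_nth[of "eta \<omega>"] linear_form_def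
      sum_index observation_coeff_def var_def sum_distrib_left mult_ac)

lemma fourier_covariance_eq:
  "fourier_covariance P (signal r v a) $ k $ l = form_covariance (signal_coeff v k) (signal_coeff v l)"
proof -
  have "has_bochner_integral P
      (\<lambda>\<omega>. linear_form (signal_coeff v k) \<omega> * cnj (linear_form (signal_coeff v l) \<omega>))
      (form_covariance (signal_coeff v k) (signal_coeff v l))"
    by (rule has_bochner_integral_over_shifts[where g = "\<lambda>_ \<omega>. linear_form (signal_coeff v k) \<omega>
          * cnj (linear_form (signal_coeff v l) \<omega>)"]) (rule linear_form_second_moment)
  then show ?thesis
    by (simp add: fourier_covariance_def dft_signal_linear_form has_bochner_integral_integral_eq)
qed

lemma fourier_covariance_hermitian:
  fixes v :: "nat \<Rightarrow> complex ^ 'n mod_ring"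
  shows "fourier_covariance P (signal r v a) $ l $ k = cnj (fourier_covariance P (signal r v a) $ k $ l)"
  by (simp add: fourier_covariance_eq form_covariance_def mult_ac)

lemma covariance_hermitian: "covariance v l k = cnj (covariance v k l)"
  unfolding covariance_def fourier_covariance_hermitian[of v l k] by simp

text \<open>The noise carries no shift phase, but it contributes only for \<open>k = l\<close>,
  where the phase is \<open>1\<close>; so the phase factors out of the whole covariance.\<close>

lemma form_covariance_observation_coeff:
  "form_covariance (observation_coeff v t k) (observation_coeff v t l) = fourier_char (t * (k - l)) * covariance v k l"
proof -
  have phase: "fourier_char (t * k) * cnj (fourier_char (t * l)) = fourier_char (t * (k - l))"
    by (simp add: cnj_fourier_char right_diff_distrib flip: fourier_char_add)
  have "form_covariance (observation_coeff v t k) (observation_coeff v t l)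
      = fourier_char (t * k) * cnj (fourier_char (t * l))
          * (\<Sum>i=1..r. of_real (lam i) * (dft (v i) $ k * cnj (dft (v i) $ l)))
        + of_real sigma2 * (\<Sum>m\<in>UNIV. dft_matrix $ k $ m * cnj (dft_matrix $ l $ m))"
    by (simp add: form_covariance_def sum_index observation_coeff_def weight_def sum_distrib_left mult_ac)
  also have "\<dots> = fourier_char (t * (k - l)) * covariance v k l"
    unfolding phase dft_matrix_rows_orthonormal covariance_def fourier_covariance_eq
    by (simp add: form_covariance_def sum_index signal_coeff_def weight_def distrib_left)
  finally show ?thesis .
qed

lemma observation_power_moment:
  "has_bochner_integral P (\<lambda>\<omega>. dft (observation (signal r v a) s eta \<omega>) $ k
      * cnj (dft (observation (signal r v a) s eta \<omega>) $ k)) (covariance v k k)"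
proof -
  let ?L = "\<lambda>t. linear_form (observation_coeff v t k)"
  have "has_bochner_integral P (\<lambda>\<omega>. of_bool (s \<omega> = t) * (?L t \<omega> * cnj (?L t \<omega>)))
      (of_real (shift_prob t) * covariance v k k)" for t
    using linear_form_second_moment[of t "observation_coeff v t k" "observation_coeff v t k"]
    by (simp add: form_covariance_observation_coeff)
  from has_bochner_integral_over_shifts[OF this] show ?thesis
    unfolding dft_observation_linear_form .
qed

text \<open>The phases of the shift cancel because the frequencies \<open>k1 - k2 + k3 - k4\<close> sum to \<open>0\<close>.\<close>

lemma observation_trispectrum_moment:
  fixes v :: "nat \<Rightarrow> complex ^ 'n mod_ring"
  assumes sum0: "k1 - k2 + (k3 - k4) = 0"
  defines "y \<equiv> \<lambda>\<omega>. dft (observation (signal r v a) s eta \<omega>)"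
  shows "has_bochner_integral P (\<lambda>\<omega>. y \<omega> $ k1 * cnj (y \<omega> $ k2) * y \<omega> $ k3 * cnj (y \<omega> $ k4))
    (covariance v k1 k2 * covariance v k3 k4 + covariance v k1 k4 * covariance v k3 k2)"
proof -
  let ?L = "\<lambda>t k. linear_form (observation_coeff v t k)"
  have "has_bochner_integral P
      (\<lambda>\<omega>. of_bool (s \<omega> = t) * (?L t k1 \<omega> * cnj (?L t k2 \<omega>) * ?L t k3 \<omega> * cnj (?L t k4 \<omega>)))
      (of_real (shift_prob t) *
        (covariance v k1 k2 * covariance v k3 k4 + covariance v k1 k4 * covariance v k3 k2))" for t
  proof -
    have "fourier_char (t * (k1 - k2)) * fourier_char (t * (k3 - k4)) = fourier_char (t * (k1 - k2 + (k3 - k4)))"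
      "fourier_char (t * (k1 - k4)) * fourier_char (t * (k3 - k2)) = fourier_char (t * (k1 - k2 + (k3 - k4)))"
      by (simp_all add: algebra_simps flip: fourier_char_add)
    then have phase: "fourier_char (t * (k1 - k2)) * c * (fourier_char (t * (k3 - k4)) * d) = c * d"
      "fourier_char (t * (k1 - k4)) * c * (fourier_char (t * (k3 - k2)) * d) = c * d" for c d
      unfolding sum0 by (simp_all add: mult.assoc mult.left_commute[of _ c])
    show ?thesis
      using linear_form_fourth_moment[of t "observation_coeff v t k1" "observation_coeff v t k2"
          "observation_coeff v t k3" "observation_coeff v t k4"]
      unfolding form_covariance_observation_coeff phase .
  qed
  from has_bochner_integral_over_shifts[OF this] show ?thesis
    unfolding y_def dft_observation_linear_form .
qed

text \<open>Shifts change the coefficients by unimodular factors only, so a constant computed at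
  shift \<open>0\<close> is valid for every sample.\<close>

lemma norm_dft_observation_le:
  "\<exists>c\<ge>0. \<forall>\<omega> k. cmod (dft (observation (signal r v a) s eta \<omega>) $ k) \<le> c * (\<Sum>j\<in>index. cmod (var j \<omega>))"
proof -
  have norm_coeff: "cmod (observation_coeff v t k j) = cmod (observation_coeff v 0 k j)" for t k j
    by (cases j) (simp_all add: observation_coeff_def norm_mult fourier_char_def)
  define c where "c = (\<Sum>k\<in>UNIV. \<Sum>j\<in>index. cmod (observation_coeff v 0 k j))"
  have c: "cmod (observation_coeff v t k j) \<le> c" if "j \<in> index" for t k j
  proof -
    have "cmod (observation_coeff v t k j) \<le> (\<Sum>j\<in>index. cmod (observation_coeff v 0 k j))"
      unfolding norm_coeff[of t] by (rule member_le_sum[OF that]) auto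
    also have "\<dots> \<le> c" unfolding c_def
      by (rule member_le_sum[of k UNIV "\<lambda>k. \<Sum>j\<in>index. cmod (observation_coeff v 0 k j)"])
         (auto intro: sum_nonneg)
    finally show ?thesis .
  qed
  have "cmod (dft (observation (signal r v a) s eta \<omega>) $ k) \<le> c * (\<Sum>j\<in>index. cmod (var j \<omega>))" for \<omega> k
  proof -
    have "cmod (linear_form (observation_coeff v (s \<omega>) k) \<omega>) \<le> (\<Sum>j\<in>index. c * cmod (var j \<omega>))"
      unfolding linear_form_def
      by (intro sum_norm_le) (simp add: norm_mult mult_right_mono c)
    then show ?thesis by (simp add: dft_observation_linear_form sum_distrib_left)
  qed
  moreover have "c \<ge> 0" unfolding c_def by (intro sum_nonneg) auto
  ultimately show ?thesis by blast
qed

lemma observation_measurable: "observation (signal r v a) s eta \<in> borel_measurable P"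
proof -
  have "observation (signal r v a) s eta
      = (\<lambda>\<omega>. \<chi> l. (\<Sum>i=1..r. a i \<omega> * (\<Sum>t\<in>UNIV. of_bool (s \<omega> = t) * v i $ (l - t))) + eta \<omega> $ l)"
    by (simp add: fun_eq_iff vec_eq_iff observation_def cyclic_shift_def signal_def sum_component
        of_bool_def if_distrib[of "\<lambda>x. x * _"] cong: if_cong)
  also have "\<dots> \<in> borel_measurable P"
  proof (intro borel_measurable_vec_lambda borel_measurable_add borel_measurable_sum borel_measurable_times)
    fix l t :: "'n mod_ring" and i assume "i \<in> {1..r}"
    then show "a i \<in> borel_measurable P" by (rule a_measurable)
    show "(\<lambda>\<omega>. of_bool (s \<omega> = t) :: complex) \<in> borel_measurable P" by measurable
  qed measurable
  finally show ?thesis .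
qed

end

section \<open>From the empirical spectra to the estimator\<close>

lemma borel_measurable_dft_nth [measurable]: "(\<lambda>y. dft y $ k) \<in> borel_measurable borel"
  unfolding dft_nth by measurable

lemma trispectrum_est_add:
  "trispectrum_est N y k1 (k1 + m) (k2 + m) = (\<Sum>i=1..N. dft (y i) $ k1 * cnj (dft (y i) $ (k1 + m)) *
      dft (y i) $ (k2 + m) * cnj (dft (y i) $ k2)) / of_nat N"
proof -
  have "k1 - (k1 + m) + (k2 + m) = k2" by (simp add: algebra_simps)
  then show ?thesis by (simp add: trispectrum_est_def)
qed

theorem theorem7:
  fixes P :: "'p measure" and M :: "'w measure"
    and r :: nat
    and v :: "nat \<Rightarrow> complex ^ 'n::finite mod_ring"
    and lam :: "nat \<Rightarrow> real" and sigma2 :: real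
    and a :: "nat \<Rightarrow> 'p \<Rightarrow> complex"
    and s :: "'p \<Rightarrow> 'n mod_ring"
    and eta :: "'p \<Rightarrow> complex ^ 'n mod_ring"
    and Y :: "nat \<Rightarrow> 'w \<Rightarrow> complex ^ 'n mod_ring"
    and C :: "nat \<Rightarrow> 'w \<Rightarrow> complex ^ 'n mod_ring ^ 'n mod_ring"
  assumes "prob_space P"
    and "\<forall>i\<in>{1..r}. \<forall>j\<in>{1..r}. cinner (v i) (v j) = (if i = j then 1 else 0)"
    and "\<forall>i\<in>{1..r}. lam i > 0"
    and "sigma2 \<ge> 0"
    and "\<forall>i\<in>{1..r}. a i \<in> measurable P borel \<and> distr P borel (a i) = complex_normal (lam i)"
    and "s \<in> measurable P (count_space UNIV)"
    and "eta \<in> measurable P borel" and "distr P borel eta = complex_normal_vec sigma2"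
    and "indep_sources P r a s eta"
    and "prob_space M"
    and "prob_space.indep_vars M (\<lambda>_. borel) Y {1..}"
    and "\<forall>i\<ge>1. distr M borel (Y i) = distr P borel (observation (signal r v a) s eta)"
    and "\<forall>i j. fourier_covariance P (signal r v a) $ i $ j \<noteq> 0"
    and "\<forall>N\<ge>1. \<forall>\<omega>\<in>space M. covariance_estimate sigma2 N (\<lambda>i. Y i \<omega>) (C N \<omega>)"
  shows "AE \<omega> in M.
           (\<lambda>N. phase_error (C N \<omega>) (fourier_covariance P (signal r v a))) \<longlonglongrightarrow> 0"
proof -
  interpret observation_model P r lam sigma2 a s eta
    unfolding observation_model_def observation_model_axioms_def using assms by auto
  interpret M: prob_space M by fact
  let ?obs = "observation (signal r v a) s eta"
  define D where "D = distr P borel ?obs"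
  have D: "distr M borel (Y i) = D" if "i \<ge> 1" for i
    using assms that by (simp add: D_def)
  obtain c where c0: "c \<ge> 0"
    and c: "\<And>\<omega> k. cmod (dft (?obs \<omega>) $ k) \<le> c * (\<Sum>j\<in>index. cmod (var j \<omega>))"
    using norm_dft_observation_le[of v] by blast
  define B where "B \<omega> = (\<Sum>j\<in>index. cmod (var j \<omega>))" for \<omega>
  \<comment> \<open>The strong law needs square integrability, so the bound is applied with degree
    \<open>4\<close> for the power spectrum and \<open>8\<close> for the trispectrum.\<close>
  have int_bound: "integrable D f"
    if f: "f \<in> borel_measurable borel" and le: "\<And>\<omega>. \<bar>f (?obs \<omega>)\<bar> \<le> (c * B \<omega>) ^ deg"
    for f :: "complex ^ 'n mod_ring \<Rightarrow> real" and deg :: nat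
    unfolding D_def integrable_distr_eq[OF observation_measurable f]
  proof (rule Bochner_Integration.integrable_bound)
    show "integrable P (\<lambda>\<omega>. c ^ deg * B \<omega> ^ deg)"
      unfolding B_def by (intro integrable_mult_right integrable_sum_norm_var_power)
    show "(\<lambda>\<omega>. f (?obs \<omega>)) \<in> borel_measurable P"
      using measurable_comp[OF observation_measurable f] by (simp add: comp_def)
    have "\<bar>f (?obs \<omega>)\<bar> \<le> \<bar>c ^ deg * B \<omega> ^ deg\<bar>" for \<omega>
      using le[of \<omega>] by (simp add: power_mult_distrib)
    then show "AE \<omega> in P. norm (f (?obs \<omega>)) \<le> norm (c ^ deg * B \<omega> ^ deg)" by simp
  qed
  have power: "AE \<omega> in M. (\<lambda>N. power_spectrum_est N (\<lambda>i. Y i \<omega>) $ k) \<longlonglongrightarrow> Re (covariance v k k)" for k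
  proof -
    define f where "f y = (cmod (dft y $ k))\<^sup>2" for y :: "complex ^ 'n mod_ring"
    have f: "f \<in> borel_measurable borel" unfolding f_def[abs_def] by measurable
    have "integrable D (\<lambda>y. (f y)\<^sup>2)"
    proof (rule int_bound)
      have "((cmod (dft (?obs \<omega>) $ k))\<^sup>2)\<^sup>2 \<le> (c * B \<omega>) ^ 4" for \<omega>
        unfolding power_mult[symmetric] using c[of \<omega> k] by (simp add: B_def power_mono)
      then show "\<bar>(f (?obs \<omega>))\<^sup>2\<bar> \<le> (c * B \<omega>) ^ 4" for \<omega> by (simp add: f_def)
    qed (use f in measurable)
    from M.strong_law_real[OF assms(11) D f this]
    have law: "AE \<omega> in M. (\<lambda>N. (\<Sum>i=1..N. f (Y i \<omega>)) / N) \<longlonglongrightarrow> integral\<^sup>L D f" by simp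
    have "has_bochner_integral P (\<lambda>\<omega>. f (?obs \<omega>)) (Re (covariance v k k))"
      using has_bochner_integral_Re[OF observation_power_moment[of v k]]
      by (simp add: f_def complex_mult_cnj cmod_power2)
    then have "integral\<^sup>L D f = Re (covariance v k k)"
      unfolding D_def integral_distr[OF observation_measurable f] by (rule has_bochner_integral_integral_eq)
    with law show ?thesis by (simp add: power_spectrum_est_def f_def)
  qed
  have tri: "AE \<omega> in M. (\<lambda>N. trispectrum_est N (\<lambda>i. Y i \<omega>) k1 (k1 + m) (k2 + m)) \<longlonglongrightarrow>
      covariance v k1 (k1 + m) * cnj (covariance v k2 (k2 + m))
      + covariance v k1 k2 * cnj (covariance v (k1 + m) (k2 + m))" for k1 k2 m
  proof -
    define f where "f y = dft y $ k1 * cnj (dft y $ (k1 + m)) * dft y $ (k2 + m) * cnj (dft y $ k2)"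
      for y :: "complex ^ 'n mod_ring"
    have f: "f \<in> borel_measurable borel" unfolding f_def[abs_def] by measurable
    have "integrable D (\<lambda>y. (cmod (f y))\<^sup>2)"
    proof (rule int_bound)
      fix \<omega>
      have "cmod (f (?obs \<omega>)) \<le> (c * B \<omega>) * (c * B \<omega>) * (c * B \<omega>) * (c * B \<omega>)"
        unfolding f_def norm_mult complex_mod_cnj B_def
        using c0 by (intro mult_mono c mult_nonneg_nonneg sum_nonneg) auto
      then have "(cmod (f (?obs \<omega>)))\<^sup>2 \<le> ((c * B \<omega>) ^ 4)\<^sup>2"
        by (intro power_mono) (simp_all add: power4_eq_xxxx)
      then show "\<bar>(cmod (f (?obs \<omega>)))\<^sup>2\<bar> \<le> (c * B \<omega>) ^ 8"
        by (simp flip: power_mult)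
    qed (use f in measurable)
    from M.strong_law_complex[OF assms(11) D f this]
    have law: "AE \<omega> in M. (\<lambda>N. (\<Sum>i=1..N. f (Y i \<omega>)) / of_nat N) \<longlonglongrightarrow> integral\<^sup>L D f" by simp
    \<comment> \<open>The frequencies balance, so the random phases cancel; hermiticity then brings
      the moment into the form of the limit.\<close>
    have "k1 - (k1 + m) + (k2 + m - k2) = 0" by (simp add: algebra_simps)
    from observation_trispectrum_moment[OF this, of v]
    have "integral\<^sup>L D f = covariance v k1 (k1 + m) * covariance v (k2 + m) k2
        + covariance v k1 k2 * covariance v (k2 + m) (k1 + m)"
      unfolding D_def integral_distr[OF observation_measurable f] f_def
      by (rule has_bochner_integral_integral_eq)
    then have "integral\<^sup>L D f = covariance v k1 (k1 + m) * cnj (covariance v k2 (k2 + m))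
        + covariance v k1 k2 * cnj (covariance v (k1 + m) (k2 + m))"
      unfolding covariance_hermitian[of v "k2 + m" k2] covariance_hermitian[of v "k2 + m" "k1 + m"] .
    with law show ?thesis by (simp add: trispectrum_est_add f_def)
  qed
  \<comment> \<open>There are finitely many index tuples, so a single null set serves for all of
    them.\<close>
  have "AE \<omega> in M. \<forall>k. (\<lambda>N. power_spectrum_est N (\<lambda>i. Y i \<omega>) $ k) \<longlonglongrightarrow> Re (covariance v k k)"
    using power by (simp add: AE_all_countable)
  moreover have "AE \<omega> in M. \<forall>k1 k2 m. (\<lambda>N. trispectrum_est N (\<lambda>i. Y i \<omega>) k1 (k1 + m) (k2 + m)) \<longlonglongrightarrow>
      covariance v k1 (k1 + m) * cnj (covariance v k2 (k2 + m))
      + covariance v k1 k2 * cnj (covariance v (k1 + m) (k2 + m))"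
    using tri by (simp add: AE_all_countable)
  moreover have "AE \<omega> in M. \<omega> \<in> space M" by (rule AE_space)
  ultimately show ?thesis
  proof eventually_elim
    case (elim \<omega>)
    show ?case
    proof (rule phase_error_tendsto)
      show "(\<lambda>N. power_spectrum_est N (\<lambda>i. Y i \<omega>) $ k) \<longlonglongrightarrow>
          Re (fourier_covariance P (signal r v a) $ k $ k + (if k = k then of_real sigma2 else 0))" for k
        using elim(1) unfolding covariance_def by blast
      show "(\<lambda>N. trispectrum_est N (\<lambda>i. Y i \<omega>) k1 (k1 + m) (k2 + m)) \<longlonglongrightarrow>
          (fourier_covariance P (signal r v a) $ k1 $ (k1 + m) + (if k1 = k1 + m then of_real sigma2 else 0))
          * cnj (fourier_covariance P (signal r v a) $ k2 $ (k2 + m) + (if k2 = k2 + m then of_real sigma2 else 0))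
          + (fourier_covariance P (signal r v a) $ k1 $ k2 + (if k1 = k2 then of_real sigma2 else 0))
          * cnj (fourier_covariance P (signal r v a) $ (k1 + m) $ (k2 + m)
              + (if k1 + m = k2 + m then of_real sigma2 else 0))" for k1 k2 m
        using elim(2) unfolding covariance_def by blast
      show "covariance_estimate sigma2 N (\<lambda>i. Y i \<omega>) (C N \<omega>)" if "N \<ge> 1" for N
        using assms(14) elim(3) that by blast
    qed (use assms(13) in \<open>auto intro: fourier_covariance_hermitian\<close>)
  qed
qed

end
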